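(* Let $n>3$ be an integer and let $C$ be a code of blocklength $n$ such that no code $C'$ equivalent to $C$ is linear, Class-I, or Class-II. Then there exists a code $D$ of blocklength $n$ that is universally strictly better than $C$, i.e. $\lambda_D(\varepsilon)>\lambda_C(\varepsilon)$ for all $0<\varepsilon<1/2$.
   Context: A code of blocklength $n$ (an "$(n,4)$ code") is here an arbitrary $4\times n$ binary matrix $C$ (repeated rows are allowed), with rows (codewords) $r_0,r_1,r_2,r_3\in\{0,1\}^n$ and $n$ columns in $\{0,1\}^4$. For $y\in\{0,1\}^n$ let $d_C(y)=\min_{0\le j\le 3} d_H(r_j,y)$, where $d_H$ is Hamming distance, and $$\lambda_C(\varepsilon)=\tfrac14\sum_{y\in\{0,1\}^n}(1-\varepsilon)^{n-d_C(y)}\varepsilon^{d_C(y)}.$$ Two codes are equivalent if one is obtained from the other by a permutation of the rows, a permutation of the columns, and flipping all four bits in some subset of the columns. The type of a column $(b_0,b_1,b_2,b_3)^T$ ($b_j$ the entry in row $j$) is the integer $8b_0+4b_1+2b_2+b_3\in\{0,\dots,15\}$. $|i|_C$ denotes the number of columns of $C$ of type $i$. Linear: $C$ is linear if every column has type in $\{0,3,5,6\}$ and at least two of $|3|_C,|5|_C,|6|_C$ are positive. Class-I: $|1|_C+|3|_C+|5|_C+|6|_C=n$, $|1|_C$ is odd, and $|3|_C,|5|_C,|6|_C$ are all even or all odd. Class-II: $|1|_C+|3|_C+|5|_C+|6|_C=n$, $|1|_C>0$, and either ($|1|_C$ and $|3|_C$ are even and $|5|_C$ and $|6|_C$ are odd)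 or ($|1|_C$, $|5|_C$ and $|6|_C$ are even and $|3|_C$ is odd). *)

theory Defs
  imports Complex_Main "Jordan_Normal_Form.Matrix"
begin

text \<open>
  An \<open>(n,4)\<close> code is an arbitrary element of \<open>codes n\<close>: its codewords are the rows \<open>0, \<dots>, 3\<close>,
  repetitions being allowed. Bits are Booleans, so flipping a bit is negation and
  \<open>\<noteq>\<close> is exclusive or.
\<close>

definition codes :: "nat \<Rightarrow> bool mat set" where
  "codes n = carrier_mat 4 n"

text \<open>Only meaningful for vectors of equal dimension.\<close>

definition hamming_dist :: "'a vec \<Rightarrow> 'a vec \<Rightarrow> nat" where
  "hamming_dist u v = card {k. k < dim_vec u \<and> u $ k \<noteq> v $ k}"

definition code_dist :: "bool mat \<Rightarrow> bool vec \<Rightarrow> nat" where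
  "code_dist C y = Min ((\<lambda>j. hamming_dist (row C j) y) ` {0..<4})"

text \<open>
  The sum ranges over the finite set of all \<open>2 ^ n\<close> words of length \<open>n = dim_col C\<close>;
  \<open>code_dist C y \<le> n\<close> there, so the subtraction does not truncate.
\<close>

definition success_prob :: "bool mat \<Rightarrow> real \<Rightarrow> real" where
  "success_prob C \<epsilon> =
     1 / 4 * (\<Sum>y\<in>carrier_vec (dim_col C).
                (1 - \<epsilon>) ^ (dim_col C - code_dist C y) * \<epsilon> ^ code_dist C y)"

definition univ_strictly_better :: "bool mat \<Rightarrow> bool mat \<Rightarrow> bool" where
  "univ_strictly_better D C \<longleftrightarrow>
     (\<forall>\<epsilon>. 0 < \<epsilon> \<and> \<epsilon> < 1 / 2 \<longrightarrow> success_prob D \<epsilon> > success_prob C \<epsilon>)"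

text \<open>
  Row permutation \<open>\<sigma>\<close>, column permutation \<open>\<pi>\<close>, and complementation of the columns in \<open>S\<close>.
  Arbitrary compositions of these operations reduce to this normal form.
\<close>

definition code_equiv :: "bool mat \<Rightarrow> bool mat \<Rightarrow> bool" where
  "code_equiv C C' \<longleftrightarrow>
     (\<exists>\<sigma> \<pi> S. bij_betw \<sigma> {0..<4} {0..<4} \<and>
             bij_betw \<pi> {0..<dim_col C} {0..<dim_col C} \<and>
             S \<subseteq> {0..<dim_col C} \<and>
             C' = mat 4 (dim_col C) (\<lambda>(i, k). C $$ (\<sigma> i, \<pi> k) \<noteq> (k \<in> S)))"

definition col_type :: "bool mat \<Rightarrow> nat \<Rightarrow> nat" where
  "col_type C k = 8 * of_bool (C $$ (0, k)) + 4 * of_bool (C $$ (1, k))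
                + 2 * of_bool (C $$ (2, k)) + of_bool (C $$ (3, k))"

definition num_type :: "bool mat \<Rightarrow> nat \<Rightarrow> nat" where
  "num_type C i = card {k. k < dim_col C \<and> col_type C k = i}"

definition linear_code :: "bool mat \<Rightarrow> bool" where
  "linear_code C \<longleftrightarrow>
     (\<forall>k < dim_col C. col_type C k \<in> {0, 3, 5, 6}) \<and>
     card {i \<in> {3, 5, 6}. num_type C i > 0} \<ge> 2"

definition class_I :: "bool mat \<Rightarrow> bool" where
  "class_I C \<longleftrightarrow>
     num_type C 1 + num_type C 3 + num_type C 5 + num_type C 6 = dim_col C \<and>
     odd (num_type C 1) \<and>
     ((even (num_type C 3) \<and> even (num_type C 5) \<and> even (num_type C 6)) \<or>
      (odd (num_type C 3) \<and> odd (num_type C 5) \<and> odd (num_type C 6)))"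

definition class_II :: "bool mat \<Rightarrow> bool" where
  "class_II C \<longleftrightarrow>
     num_type C 1 + num_type C 3 + num_type C 5 + num_type C 6 = dim_col C \<and>
     num_type C 1 > 0 \<and>
     ((even (num_type C 1) \<and> even (num_type C 3) \<and> odd (num_type C 5) \<and> odd (num_type C 6)) \<or>
      (even (num_type C 1) \<and> even (num_type C 5) \<and> even (num_type C 6) \<and> odd (num_type C 3)))"

end

theory Submission
  imports Defs
begin

text \<open>
  Put \<open>q = \<epsilon> / (1 - \<epsilon>)\<close>. Up to a factor that is the same for all codes of length \<open>n\<close>, the success
  probability is the weight \<open>\<Sum>\<^sub>y q ^ d(y)\<close>, where \<open>d(y)\<close> is the distance of the word \<open>y\<close> to the code.
  Delete a column \<open>x\<close>. A word \<open>y\<close> of the shorter code, at distance \<open>m\<close>, is extended by both bits.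
  If all codewords nearest to \<open>y\<close> agree in column \<open>x\<close>, then one extension keeps the distance \<open>m\<close> and the
  other has distance \<open>m + 1\<close>; if column \<open>x\<close> splits the nearest codewords, both extensions keep \<open>m\<close>.
  So the weight is \<open>(1 + q)\<close> times that of the shorter code plus \<open>(1 - q)\<close> times the weight of the words
  whose nearest codewords are split (\<open>weight_insert\<close>). Exchanging one column for another therefore
  improves the code for every \<open>\<epsilon>\<close> at once as soon as the set of split words grows
  (\<open>beaten_by_set_column\<close>), and the whole proof compares such sets.

  Two things control them. Codewords can only tie at a word if their distance is even
  (\<open>even_dist_if_nearest\<close>), and having even distance is an equivalence relation on rows with at most
  two classes. Conversely, ties exist: among three rows at pairwise even distances there is one
  (\<open>three_even_rows_tie\<close>), and if the rows fall into two classes of two, then each class is the exact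
  set of nearest rows of some word (\<open>two_two_tie\<close>), unless every column is constant or one of the two
  pairings that separate both classes.

  Up to complementation a column is constant, distinguishes a lone row \<open>i\<close> from the others, or pairs
  the rows up as \<open>ij|kl\<close>.
  \<^item> A constant column splits nothing, so any tie in the rest of the code gives an improvement; the
    exception in \<open>two_two_tie\<close> makes the code linear.
  \<^item> A lone column at \<open>i\<close> splits the nearest rows exactly when \<open>i\<close> ties with another row. If \<open>i\<close> and
    \<open>j\<close> have odd distance in the rest of the code, then they never tie and the pairing \<open>ij|kl\<close> splits
    everything that the lone column splits. For a suitable such \<open>j\<close> it splits more if \<open>i\<close> is alone in its
    parity class or has exactly one companion. If \<open>i\<close> has two or three companions and
    there is a lone column at another row \<open>i'\<close>, then, possibly after the harmless exchange by \<open>ij|kl\<close>,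
    row \<open>i'\<close> has exactly one companion in the code without that column. What is left is that all lone
    columns are at \<open>i\<close>, and the parities of the distances then say that the code is Class-I (three
    companions) or Class-II (two companions).
  \<^item> With pairings only, the code is linear unless it uses a single pairing. In that case rows coincide, and
    another pairing is better.

  The one place that does not follow this pattern is a single lone column at \<open>i\<close> next to two kinds of
  pairings, \<open>ij|kl\<close> and \<open>il|jk\<close>, both an odd number of times: here a column of a repeated pairing is
  exchanged for the third pairing (\<open>lone_with_repeated_pairing_beaten\<close>). A repeated pairing
  exists because \<open>n > 3\<close>.
\<close>

section \<open>Codes as families of columns\<close>

text \<open>
  A code is given by its entries \<open>c r x\<close> in row \<open>r\<close> and column \<open>x\<close>, where \<open>x\<close> ranges over a finite set \<open>K\<close>;
  a word is the set \<open>y \<subseteq> K\<close> of the positions of its ones. Columns are not required to be numbered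
  consecutively, so that one of them can be deleted without renumbering the others.
\<close>

definition word_dist :: "(nat \<Rightarrow> nat \<Rightarrow> bool) \<Rightarrow> nat set \<Rightarrow> nat \<Rightarrow> nat set \<Rightarrow> nat" where
  "word_dist c K r y = card {x \<in> K. c r x \<noteq> (x \<in> y)}"

definition min_dist :: "(nat \<Rightarrow> nat \<Rightarrow> bool) \<Rightarrow> nat set \<Rightarrow> nat set \<Rightarrow> nat" where
  "min_dist c K y = Min ((\<lambda>r. word_dist c K r y) ` {0..<4})"

text \<open>
  With \<open>q = \<epsilon> / (1 - \<epsilon>)\<close> this is \<open>4 / (1 - \<epsilon>) ^ n\<close> times the success probability.
\<close>

definition weight :: "(nat \<Rightarrow> nat \<Rightarrow> bool) \<Rightarrow> nat set \<Rightarrow> real \<Rightarrow> real" where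
  "weight c K q = (\<Sum>y\<in>Pow K. q ^ min_dist c K y)"

definition nearest :: "(nat \<Rightarrow> nat \<Rightarrow> bool) \<Rightarrow> nat set \<Rightarrow> nat set \<Rightarrow> nat set" where
  "nearest c K y = {r. r < 4 \<and> (\<forall>s<4. word_dist c K r y \<le> word_dist c K s y)}"

text \<open>
  Here \<open>b\<close> is a column and \<open>A\<close> a set of rows, in practice the rows nearest to some word.
\<close>

definition splits :: "(nat \<Rightarrow> bool) \<Rightarrow> nat set \<Rightarrow> bool" where
  "splits b A \<longleftrightarrow> (\<exists>r\<in>A. \<exists>s\<in>A. b r \<noteq> b s)"

definition set_column ::
  "(nat \<Rightarrow> nat \<Rightarrow> bool) \<Rightarrow> nat \<Rightarrow> (nat \<Rightarrow> bool) \<Rightarrow> nat \<Rightarrow> nat \<Rightarrow> bool" where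
  "set_column c x b = (\<lambda>r k. if k = x then b r else c r k)"

definition diff_cols :: "(nat \<Rightarrow> nat \<Rightarrow> bool) \<Rightarrow> nat set \<Rightarrow> nat \<Rightarrow> nat \<Rightarrow> nat set" where
  "diff_cols c K r s = {x \<in> K. c r x \<noteq> c s x}"

definition even_dist :: "(nat \<Rightarrow> nat \<Rightarrow> bool) \<Rightarrow> nat set \<Rightarrow> nat \<Rightarrow> nat \<Rightarrow> bool" where
  "even_dist c K r s \<longleftrightarrow> even (card (diff_cols c K r s))"

text \<open>
  The rows are listed in an arbitrary order, so that one lemma serves all relabellings.
\<close>

definition all_rows :: "nat \<Rightarrow> nat \<Rightarrow> nat \<Rightarrow> nat \<Rightarrow> bool" where
  "all_rows i j k l \<longleftrightarrow> distinct [i, j, k, l] \<and> {0..<4} = {i, j, k, l}"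

definition beaten :: "(nat \<Rightarrow> nat \<Rightarrow> bool) \<Rightarrow> nat set \<Rightarrow> bool" where
  "beaten c K \<longleftrightarrow> (\<exists>c'. \<forall>q. 0 < q \<and> q < 1 \<longrightarrow> weight c K q < weight c' K q)"

section \<open>Exchanging one column\<close>

lemma min_dist_attained:
  obtains r where "r \<in> nearest c K y" "word_dist c K r y = min_dist c K y"
proof -
  have "min_dist c K y \<in> (\<lambda>r. word_dist c K r y) ` {0..<4}"
    unfolding min_dist_def by (rule Min_in) auto
  then obtain r where r: "r < 4" "word_dist c K r y = min_dist c K y" by auto
  then have "r \<in> nearest c K y"
    by (auto simp: nearest_def min_dist_def)
  with r show thesis using that by blast
qed

lemma min_dist_le: "r < 4 \<Longrightarrow> min_dist c K y \<le> word_dist c K r y"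
  unfolding min_dist_def by (intro Min_le) auto

lemma nearest_iff: "r \<in> nearest c K y \<longleftrightarrow> r < 4 \<and> word_dist c K r y = min_dist c K y"
proof -
  obtain r' where r': "r' \<in> nearest c K y" "word_dist c K r' y = min_dist c K y"
    by (rule min_dist_attained)
  then have "r' < 4" by (simp add: nearest_def)
  show ?thesis
  proof
    assume r: "r \<in> nearest c K y"
    then have "r < 4" "word_dist c K r y \<le> word_dist c K r' y"
      using \<open>r' < 4\<close> by (auto simp: nearest_def)
    then show "r < 4 \<and> word_dist c K r y = min_dist c K y"
      using r' min_dist_le[of r c K y] by simp
  next
    assume "r < 4 \<and> word_dist c K r y = min_dist c K y"
    then show "r \<in> nearest c K y" using min_dist_le by (simp add: nearest_def)
  qed
qed

lemma min_dist_eqI: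
  assumes "\<And>s. s < 4 \<Longrightarrow> m \<le> word_dist c K s y" "r < 4" "word_dist c K r y = m"
  shows "min_dist c K y = m"
proof -
  obtain s where "s \<in> nearest c K y" "word_dist c K s y = min_dist c K y"
    by (rule min_dist_attained)
  then have "m \<le> min_dist c K y" using assms(1)[of s] by (simp add: nearest_def)
  then show ?thesis using min_dist_le[OF assms(2), of c K y] assms(3) by simp
qed

lemma word_dist_insert:
  assumes "finite K" "x \<notin> K"
  shows "word_dist c (insert x K) r y = word_dist c K r (y - {x}) + of_bool (c r x \<noteq> (x \<in> y))"
proof -
  have "{z \<in> insert x K. c r z \<noteq> (z \<in> y)} =
      (if c r x \<noteq> (x \<in> y) then insert x else id) {z \<in> K. c r z \<noteq> (z \<in> y - {x})}"
    using assms by auto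
  then show ?thesis using assms by (auto simp: word_dist_def)
qed

text \<open>
  The minimum goes up exactly if each nearest row disagrees with the new bit: a row that is not
  nearest is already at distance at least one more than the minimum.
\<close>

lemma min_dist_insert:
  assumes "finite K" "x \<notin> K"
  shows "min_dist c (insert x K) y = min_dist c K (y - {x}) +
    of_bool (\<forall>r\<in>nearest c K (y - {x}). c r x \<noteq> (x \<in> y))"
proof (cases "\<forall>r\<in>nearest c K (y - {x}). c r x \<noteq> (x \<in> y)")
  case True
  obtain r where r: "r \<in> nearest c K (y - {x})" by (rule min_dist_attained)
  have "min_dist c K (y - {x}) + 1 \<le> word_dist c (insert x K) s y" if "s < 4" for s
    using True min_dist_le[OF that, of c K "y - {x}"] that
    by (cases "s \<in> nearest c K (y - {x})") (auto simp: word_dist_insert[OF assms] nearest_iff)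
  then have "min_dist c (insert x K) y = min_dist c K (y - {x}) + 1"
    using r True by (intro min_dist_eqI[where r = r]) (auto simp: word_dist_insert[OF assms] nearest_iff)
  then show ?thesis using True by simp
next
  case False
  then obtain r where r: "r \<in> nearest c K (y - {x})" "c r x = (x \<in> y)" by blast
  have "min_dist c (insert x K) y = min_dist c K (y - {x})"
    using r by (intro min_dist_eqI[where r = r])
      (auto simp: word_dist_insert[OF assms] nearest_iff min_dist_le trans_le_add1)
  then show ?thesis using False by simp
qed

text \<open>
  The two extensions of \<open>y\<close> contribute \<open>q ^ m + q ^ (m + 1)\<close>, or \<open>2 * q ^ m\<close> if the nearest rows of \<open>y\<close> are
  split by the new column.
\<close>

lemma weight_insert:
  assumes "finite K" "x \<notin> K"
  shows "weight c (insert x K) q =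
    (\<Sum>y\<in>Pow K. q ^ min_dist c K y *
      (1 + q + of_bool (splits (\<lambda>r. c r x) (nearest c K y)) * (1 - q)))"
proof -
  have "weight c (insert x K) q =
      (\<Sum>y\<in>Pow K. q ^ min_dist c (insert x K) y) + (\<Sum>y\<in>insert x ` Pow K. q ^ min_dist c (insert x K) y)"
    unfolding weight_def Pow_insert using assms by (intro sum.union_disjoint) auto
  also have "(\<Sum>y\<in>insert x ` Pow K. q ^ min_dist c (insert x K) y) =
      (\<Sum>y\<in>Pow K. q ^ min_dist c (insert x K) (insert x y))"
  proof -
    have "inj_on (insert x) (Pow K)"
      using assms by (auto intro!: inj_onI simp: insert_ident)
    then show ?thesis by (simp add: sum.reindex)
  qed
  also have "(\<Sum>y\<in>Pow K. q ^ min_dist c (insert x K) y) + \<dots> =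
    (\<Sum>y\<in>Pow K. q ^ min_dist c K y *
      (1 + q + of_bool (splits (\<lambda>r. c r x) (nearest c K y)) * (1 - q)))"
    unfolding sum.distrib[symmetric]
  proof (rule sum.cong[OF refl])
    fix y assume y: "y \<in> Pow K"
    then have *: "x \<notin> y" "y - {x} = y" "insert x y - {x} = y" using assms by auto
    let ?P = "\<forall>r\<in>nearest c K y. c r x" and ?Q = "\<forall>r\<in>nearest c K y. \<not> c r x"
    obtain r where "r \<in> nearest c K y" by (rule min_dist_attained)
    then have "\<not> (?P \<and> ?Q)" by blast
    moreover have "splits (\<lambda>r. c r x) (nearest c K y) \<longleftrightarrow> \<not> ?P \<and> \<not> ?Q"
      unfolding splits_def by blast
    moreover have "min_dist c (insert x K) y = min_dist c K y + of_bool ?P"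
      "min_dist c (insert x K) (insert x y) = min_dist c K y + of_bool ?Q"
      using * unfolding min_dist_insert[OF assms] by simp_all
    ultimately show "q ^ min_dist c (insert x K) y + q ^ min_dist c (insert x K) (insert x y) =
      q ^ min_dist c K y * (1 + q + of_bool (splits (\<lambda>r. c r x) (nearest c K y)) * (1 - q))"
      by (cases ?P; cases ?Q) (simp_all only: of_bool_eq power_add power_one_right, simp_all add: algebra_simps)
  qed
  finally show ?thesis .
qed

lemma word_dist_set_column [simp]:
  "x \<notin> K \<Longrightarrow> word_dist (set_column c x b) K = word_dist c K"
  by (auto simp: word_dist_def set_column_def fun_eq_iff intro!: arg_cong[where f = card])

lemma min_dist_set_column [simp]: "x \<notin> K \<Longrightarrow> min_dist (set_column c x b) K = min_dist c K"
  by (simp add: min_dist_def fun_eq_iff)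

lemma nearest_set_column [simp]: "x \<notin> K \<Longrightarrow> nearest (set_column c x b) K = nearest c K"
  by (simp add: nearest_def fun_eq_iff)

lemma diff_cols_set_column [simp]: "x \<notin> K \<Longrightarrow> diff_cols (set_column c x b) K = diff_cols c K"
  by (auto simp: diff_cols_def set_column_def fun_eq_iff)

lemma weight_remove:
  assumes "finite K" "x \<in> K"
  shows "weight c K q = (\<Sum>y\<in>Pow (K - {x}). q ^ min_dist c (K - {x}) y *
    (1 + q + of_bool (splits (\<lambda>r. c r x) (nearest c (K - {x}) y)) * (1 - q)))"
  using weight_insert[of "K - {x}" x c q] assms by (simp add: insert_absorb)

lemma weight_set_column:
  assumes "finite K" "x \<in> K"
  shows "weight (set_column c x b) K q = (\<Sum>y\<in>Pow (K - {x}). q ^ min_dist c (K - {x}) y *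
    (1 + q + of_bool (splits b (nearest c (K - {x}) y)) * (1 - q)))"
proof -
  have "(\<lambda>r. set_column c x b r x) = b" by (simp add: set_column_def)
  then show ?thesis by (simp add: weight_remove[OF assms])
qed

text \<open>
  The shorter code is not affected by the exchange, so only the sets of split words matter.
\<close>

lemma weight_set_column_le:
  assumes "finite K" "x \<in> K" "0 < q" "q < 1"
    and incl: "\<And>y. y \<subseteq> K - {x} \<Longrightarrow> splits (\<lambda>r. c r x) (nearest c (K - {x}) y) \<Longrightarrow>
            splits b (nearest c (K - {x}) y)"
  shows "weight c K q \<le> weight (set_column c x b) K q"
  unfolding weight_remove[OF assms(1,2), of c] weight_set_column[OF assms(1,2)]
proof (intro sum_mono mult_left_mono)
  fix y assume "y \<in> Pow (K - {x})"
  then show "1 + q + of_bool (splits (\<lambda>r. c r x) (nearest c (K - {x}) y)) * (1 - q)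
      \<le> 1 + q + of_bool (splits b (nearest c (K - {x}) y)) * (1 - q)"
    using incl[of y] assms(4) by (cases "splits (\<lambda>r. c r x) (nearest c (K - {x}) y)") (simp_all add: zero_le_mult_iff)
qed (use assms(3) in simp)

lemma beaten_by_set_column:
  assumes "finite K" "x \<in> K"
    and incl: "\<And>y. y \<subseteq> K - {x} \<Longrightarrow> splits (\<lambda>r. c r x) (nearest c (K - {x}) y) \<Longrightarrow>
            splits b (nearest c (K - {x}) y)"
    and y: "y \<subseteq> K - {x}" "splits b (nearest c (K - {x}) y)"
      "\<not> splits (\<lambda>r. c r x) (nearest c (K - {x}) y)"
  shows "beaten c K"
proof -
  have "weight c K q < weight (set_column c x b) K q" if q: "0 < q" "q < 1" for q
    unfolding weight_remove[OF assms(1,2), of c] weight_set_column[OF assms(1,2)]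
  proof (rule sum_strict_mono_ex1)
    show "\<forall>y\<in>Pow (K - {x}). q ^ min_dist c (K - {x}) y *
          (1 + q + of_bool (splits (\<lambda>r. c r x) (nearest c (K - {x}) y)) * (1 - q))
        \<le> q ^ min_dist c (K - {x}) y * (1 + q + of_bool (splits b (nearest c (K - {x}) y)) * (1 - q))"
    proof (intro ballI mult_left_mono)
      fix y assume "y \<in> Pow (K - {x})"
      then show "1 + q + of_bool (splits (\<lambda>r. c r x) (nearest c (K - {x}) y)) * (1 - q)
          \<le> 1 + q + of_bool (splits b (nearest c (K - {x}) y)) * (1 - q)"
        using incl[of y] q(2) by (cases "splits (\<lambda>r. c r x) (nearest c (K - {x}) y)") (simp_all add: zero_le_mult_iff)
    qed (use q in simp)
    show "\<exists>y\<in>Pow (K - {x}). q ^ min_dist c (K - {x}) y *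
          (1 + q + of_bool (splits (\<lambda>r. c r x) (nearest c (K - {x}) y)) * (1 - q))
        < q ^ min_dist c (K - {x}) y * (1 + q + of_bool (splits b (nearest c (K - {x}) y)) * (1 - q))"
      using y q by (intro bexI[of _ y]) simp_all
  qed (use assms in simp)
  then show ?thesis unfolding beaten_def by blast
qed

section \<open>Parity\<close>

lemma card_sym_diff:
  assumes "finite A" "finite B"
  shows "card ((A - B) \<union> (B - A)) + 2 * card (A \<inter> B) = card A + card B"
proof -
  have "card A = card (A - B) + card (A \<inter> B)" "card B = card (B - A) + card (A \<inter> B)"
    using assms by (auto simp: card_Diff_subset_Int Int_commute card_mono)
  moreover have "card ((A - B) \<union> (B - A)) = card (A - B) + card (B - A)"
    using assms by (intro card_Un_disjoint) auto
  ultimately show ?thesis by simp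
qed

lemma even_dist_sym: "even_dist c K r s = even_dist c K s r"
  by (simp add: even_dist_def diff_cols_def eq_commute)

lemma even_dist_trans:
  assumes "finite K"
  shows "even_dist c K r t \<longleftrightarrow> (even_dist c K r s = even_dist c K s t)"
proof -
  let ?A = "diff_cols c K r s" and ?B = "diff_cols c K s t"
  have "diff_cols c K r t = (?A - ?B) \<union> (?B - ?A)" by (auto simp: diff_cols_def)
  with card_sym_diff[of ?A ?B] assms
  have "card (diff_cols c K r t) + 2 * card (?A \<inter> ?B) = card ?A + card ?B"
    by (auto simp: diff_cols_def)
  then show ?thesis unfolding even_dist_def by (metis even_add even_mult_iff even_numeral)
qed

text \<open>
  At most two parity classes exist, so even distance amounts to having the same colour. This turns
  reasoning about parities into propositional logic.
\<close>

lemma even_dist_colouring: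
  assumes "finite K"
  obtains f :: "nat \<Rightarrow> bool" where "\<forall>r s. even_dist c K r s \<longleftrightarrow> f r = f s"
proof
  show "\<forall>r s. even_dist c K r s \<longleftrightarrow> even_dist c K 0 r = even_dist c K 0 s"
    using even_dist_trans[OF assms, of c _ _ 0] even_dist_sym[of c K _ 0] by blast
qed

lemma even_dist_remove:
  assumes "finite K" "x \<in> K"
  shows "even_dist c K r s \<longleftrightarrow> (even_dist c (K - {x}) r s \<noteq> (c r x \<noteq> c s x))"
proof -
  have "diff_cols c K r s = (if c r x \<noteq> c s x then insert x else id) (diff_cols c (K - {x}) r s)"
    using assms by (auto simp: diff_cols_def)
  then show ?thesis using assms by (auto simp: even_dist_def diff_cols_def)
qed

lemma even_dist_set_column [simp]: "x \<notin> K \<Longrightarrow> even_dist (set_column c x b) K = even_dist c K"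
  by (simp add: even_dist_def fun_eq_iff)

lemma word_dist_add:
  assumes "finite K"
  shows "word_dist c K r y + word_dist c K s y =
    card (diff_cols c K r s) + 2 * card {x \<in> K. c r x \<noteq> (x \<in> y) \<and> c s x \<noteq> (x \<in> y)}"
proof -
  let ?A = "{x \<in> K. c r x \<noteq> (x \<in> y)}" and ?B = "{x \<in> K. c s x \<noteq> (x \<in> y)}"
  have "diff_cols c K r s = (?A - ?B) \<union> (?B - ?A)" by (auto simp: diff_cols_def)
  moreover have "?A \<inter> ?B = {x \<in> K. c r x \<noteq> (x \<in> y) \<and> c s x \<noteq> (x \<in> y)}" by auto
  ultimately show ?thesis
    using card_sym_diff[of ?A ?B] assms by (simp add: word_dist_def)
qed

text \<open>
  The distances of two rows to a word add up to the distance of the rows, modulo 2.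
\<close>

lemma even_dist_if_nearest:
  assumes "finite K" "r \<in> nearest c K y" "s \<in> nearest c K y"
  shows "even_dist c K r s"
proof -
  have "card (diff_cols c K r s) + 2 * card {x \<in> K. c r x \<noteq> (x \<in> y) \<and> c s x \<noteq> (x \<in> y)} =
      2 * min_dist c K y"
    unfolding word_dist_add[OF assms(1), symmetric] using assms(2,3) by (simp add: nearest_iff)
  then have "even (card (diff_cols c K r s) +
      2 * card {x \<in> K. c r x \<noteq> (x \<in> y) \<and> c s x \<noteq> (x \<in> y)})"
    by (metis dvd_triv_left)
  then show ?thesis by (simp add: even_dist_def)
qed

section \<open>Ties\<close>

text \<open>
  The word that arises from codeword \<open>i\<close> by changing the bits in \<open>S\<close>. All words whose nearest rows have to
  be known are constructed in this way.
\<close>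

definition flip_in_row :: "(nat \<Rightarrow> nat \<Rightarrow> bool) \<Rightarrow> nat set \<Rightarrow> nat \<Rightarrow> nat set \<Rightarrow> nat set" where
  "flip_in_row c K i S = {x \<in> K. c i x \<noteq> (x \<in> S)}"

lemma flip_in_row_subset [simp]: "flip_in_row c K i S \<subseteq> K"
  by (auto simp: flip_in_row_def)

lemma word_dist_flip:
  assumes "finite K" "S \<subseteq> K"
  shows "word_dist c K r (flip_in_row c K i S) + 2 * card (S \<inter> diff_cols c K i r) =
    card (diff_cols c K i r) + card S"
proof -
  let ?D = "diff_cols c K i r"
  have "{x \<in> K. c r x \<noteq> (x \<in> flip_in_row c K i S)} = (S - ?D) \<union> (?D - S)"
    using assms(2) by (auto simp: diff_cols_def flip_in_row_def)
  with card_sym_diff[of S ?D] show ?thesis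
    using assms finite_subset[OF assms(2)] by (simp add: word_dist_def diff_cols_def)
qed

text \<open>
  Take two rows \<open>i\<close> and \<open>j\<close> other than \<open>k\<close> whose distance \<open>2 t\<close> is as small as possible, and a midpoint: change
  \<open>t\<close> of the bits of row \<open>i\<close> in which it differs from row \<open>j\<close>. By minimality and the triangle inequality
  the fourth row has distance at least \<open>t\<close>. To keep row \<open>k\<close> at distance at least \<open>t\<close> as well, at most half
  of the positions where \<open>j\<close> and \<open>k\<close> both differ from \<open>i\<close> are changed.
\<close>

lemma three_even_rows_tie:
  assumes "finite K"
    and even: "\<And>r s. r < 4 \<Longrightarrow> s < 4 \<Longrightarrow> r \<noteq> k \<Longrightarrow> s \<noteq> k \<Longrightarrow> even_dist c K r s"
  obtains y r s where "y \<subseteq> K" "r \<noteq> s" "r \<noteq> k" "s \<noteq> k" "r \<in> nearest c K y" "s \<in> nearest c K y"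
proof -
  define P where "P = (\<lambda>(r::nat, s::nat). r < 4 \<and> s < 4 \<and> r \<noteq> s \<and> r \<noteq> k \<and> s \<noteq> k)"
  \<comment> \<open>Two distinct rows other than \<open>k\<close>.\<close>
  have "P (if k = 0 then 1 else 0, if k \<le> 1 then 2 else 1)" by (simp add: P_def)
  then obtain p where p: "P p" and least:
    "\<And>p'. P p' \<Longrightarrow> card (diff_cols c K (fst p) (snd p)) \<le> card (diff_cols c K (fst p') (snd p'))"
    using ex_has_least_nat[of P _ "\<lambda>p. card (diff_cols c K (fst p) (snd p))"] by blast
  obtain i j where ij: "p = (i, j)" by fastforce
  note pij = p[unfolded ij P_def, simplified]
  let ?D = "diff_cols c K i j" and ?Dk = "diff_cols c K i k"
  have fin: "finite ?D" "finite ?Dk" using assms(1) by (auto simp: diff_cols_def)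
  obtain t where t: "card ?D = 2 * t"
    using even pij unfolding even_dist_def by (metis evenE)
  have split: "card (?D - ?Dk) + card (?D \<inter> ?Dk) = 2 * t"
    using t fin by (metis card_Int_Diff add.commute)
  \<comment> \<open>\<open>S'\<close> are the changes that move towards row \<open>k\<close>, \<open>S''\<close> those that move away from it.\<close>
  obtain S' where S': "S' \<subseteq> ?D \<inter> ?Dk" "card S' = card (?D \<inter> ?Dk) div 2"
    using obtain_subset_with_card_n[of "card (?D \<inter> ?Dk) div 2" "?D \<inter> ?Dk"] by force
  have "t - card (?D \<inter> ?Dk) div 2 \<le> card (?D - ?Dk)" using split by linarith
  then obtain S'' where S'': "S'' \<subseteq> ?D - ?Dk" "card S'' = t - card (?D \<inter> ?Dk) div 2"
    by (meson obtain_subset_with_card_n)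
  define S where "S = S' \<union> S''"
  have finS: "finite S'" "finite S''" using S'(1) S''(1) fin by (auto intro: finite_subset)
  have "card S = card S' + card S''"
    unfolding S_def using S'(1) S''(1) finS by (intro card_Un_disjoint) auto
  then have cS: "card S = t" using S'(2) S''(2) split by linarith
  have SD: "S \<subseteq> ?D" unfolding S_def using S' S'' by auto
  then have SK: "S \<subseteq> K" by (auto simp: diff_cols_def)
  let ?y = "flip_in_row c K i S"
  note wd = word_dist_flip[OF assms(1) SK, of c _ i]
  have di: "word_dist c K i ?y = t" using wd[of i] cS by (simp add: diff_cols_def)
  have "S \<inter> ?D = S" using SD by auto
  then have dj: "word_dist c K j ?y = t" using wd[of j] cS t by simp
  have "S \<inter> ?Dk = S'" unfolding S_def using S' S'' by auto
  then have "word_dist c K k ?y + 2 * (card (?D \<inter> ?Dk) div 2) = card ?Dk + t"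
    using wd[of k] cS S'(2) by simp
  moreover have "card (?D \<inter> ?Dk) \<le> card ?Dk" using fin by (intro card_mono) auto
  ultimately have dk: "t \<le> word_dist c K k ?y" by linarith
  have "t \<le> word_dist c K s ?y" if "s < 4" for s
  proof (cases "s = i \<or> s = k")
    case True then show ?thesis using di dk by auto
  next
    case False
    then have "2 * t \<le> card (diff_cols c K i s)"
      using least[of "(i, s)"] pij t that by (simp add: ij P_def)
    moreover have "card (S \<inter> diff_cols c K i s) \<le> card S"
      using finS by (intro card_mono) (auto simp: S_def)
    ultimately show ?thesis using wd[of s] cS by linarith
  qed
  then have "i \<in> nearest c K ?y" "j \<in> nearest c K ?y"
    using di dj pij by (auto simp: nearest_def)
  then show thesis using that[of ?y i j] pij by auto
qed

text \<open>
  The numerical part of \<open>two_two_tie_if_lone_le\<close>. There \<open>a\<close>, \<open>d\<close>, \<open>u\<close>, \<open>v\<close> count the lone columns at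
  \<open>j\<close>, \<open>i\<close>, \<open>k\<close>, \<open>l\<close>, and \<open>b\<close>, \<open>g\<close>, \<open>e\<close> count the pairings \<open>ik|jl\<close>, \<open>il|jk\<close>, \<open>ij|kl\<close>; \<open>2 t\<close> is the distance
  of \<open>i\<close> and \<open>j\<close>. From \<open>i\<close> towards \<open>j\<close>, changing \<open>a'\<close>, \<open>b'\<close>, \<open>g'\<close> columns of the respective kinds leads to a midpoint,
  and the last two inequalities say that it is not closer to \<open>k\<close> or to \<open>l\<close>. Choosing the largest admissible
  numbers makes the total at least \<open>t\<close>; then they can be lowered. The two odd sums lose one half each by
  rounding, which is why some further column, counted by \<open>a\<close>, \<open>d\<close>, \<open>e\<close>, \<open>u\<close> or \<open>v\<close>, has to exist.
\<close>

lemma midpoint_sizes: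
  fixes a b g d e u v t :: nat
  assumes "a + b + g + d = 2 * t" "odd (g + d + e + u)" "odd (b + d + e + v)" "d \<le> a"
    and nz: "\<not> (a = 0 \<and> d = 0 \<and> e = 0 \<and> u = 0 \<and> v = 0)"
  obtains a' b' g' where "a' \<le> a" "b' \<le> b" "g' \<le> g" "a' + b' + g' = t"
    "2 * g' \<le> g + d + e + u" "2 * b' \<le> b + d + e + v"
proof -
  obtain m where m: "g + d + e + u = 2 * m + 1" using assms(2) by (elim oddE)
  obtain p where p: "b + d + e + v = 2 * p + 1" using assms(3) by (elim oddE)
  have "even (a + b + g + d)" using assms(1) by simp
  then have even: "even (a + d + u + v)" using assms(2,3) unfolding even_add by blast
  have "a + d + 2 * e + u + v \<noteq> 0" using nz by auto
  moreover have "a + d + 2 * e + u + v \<noteq> 1"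
  proof
    assume *: "a + d + 2 * e + u + v = 1"
    then have "e = 0" by linarith
    then have "a + d + u + v = 1" using * by linarith
    then show False using even by simp
  qed
  ultimately have c1: "2 \<le> a + d + 2 * e + u + v" by linarith
  have c2: "1 \<le> a + g + e + v"
  proof (rule ccontr)
    assume "\<not> ?thesis"
    then have "a = 0" "g = 0" "e = 0" "v = 0" "d = 0" using assms(4) by auto
    then show False using even assms(2) by simp
  qed
  have c3: "1 \<le> a + b + e + u"
  proof (rule ccontr)
    assume "\<not> ?thesis"
    then have "a = 0" "b = 0" "e = 0" "u = 0" "d = 0" using assms(4) by auto
    then show False using even assms(3) by simp
  qed
  \<comment> \<open>The largest admissible values of \<open>g'\<close> and \<open>b'\<close>. The bounds above are what is needed in the cases
    where, respectively, both, only \<open>B\<close>, and only \<open>G\<close> are cut off by the inequality.\<close>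
  define G where "G = min g m"
  define B where "B = min b p"
  have "t \<le> a + B + G"
    using assms(1,4) m p c1 c2 c3 unfolding B_def G_def by linarith
  have GB: "G \<le> g" "G \<le> m" "B \<le> b" "B \<le> p" unfolding G_def B_def by auto
  consider "t \<le> a" | "a < t" "t \<le> a + B" | "a + B < t" by linarith
  then show thesis
  proof cases
    case 1
    show thesis by (rule that[of t 0 0]) (use 1 in auto)
  next
    case 2
    show thesis by (rule that[of a "t - a" 0]) (use 2 GB p in auto)
  next
    case 3
    show thesis by (rule that[of a B "t - a - B"]) (use 3 GB m p \<open>t \<le> a + B + G\<close> in auto)
  qed
qed
text \<open>
  The number of columns in which the rows \<open>j\<close>, \<open>k\<close>, \<open>l\<close> differ from row \<open>i\<close> as prescribed. Comparing with row \<open>i\<close>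
  makes the count insensitive to complementation of columns: \<open>(True, True, True)\<close> are the lone columns at \<open>i\<close>,
  \<open>(True, False, False)\<close> those at \<open>j\<close>, \<open>(False, True, True)\<close> is the pairing \<open>ij|kl\<close>, and so on.
\<close>

definition pattern_count ::
  "(nat \<Rightarrow> nat \<Rightarrow> bool) \<Rightarrow> nat set \<Rightarrow> nat \<Rightarrow> nat \<Rightarrow> nat \<Rightarrow> nat \<Rightarrow> bool \<Rightarrow> bool \<Rightarrow> bool \<Rightarrow> nat" where
  "pattern_count c K i j k l p q r =
    card {x \<in> K. (c i x \<noteq> c j x) = p \<and> (c i x \<noteq> c k x) = q \<and> (c i x \<noteq> c l x) = r}"

lemma card_filter_sum: "finite K \<Longrightarrow> card {x \<in> K. P x} = (\<Sum>x\<in>K. of_bool (P x))"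
  by (simp add: sum_of_bool_eq Collect_conj_eq Int_commute)

lemma card_diff_cols_pattern:
  fixes c :: "nat \<Rightarrow> nat \<Rightarrow> bool" and i j k l :: nat
  assumes "finite K"
  defines "N \<equiv> pattern_count c K i j k l"
  shows "card (diff_cols c K i j) = N True False False + N True False True + N True True False + N True True True"
    and "card (diff_cols c K i k) = N False True False + N False True True + N True True False + N True True True"
    and "card (diff_cols c K i l) = N False False True + N False True True + N True False True + N True True True"
  unfolding N_def pattern_count_def diff_cols_def card_filter_sum[OF assms(1)] sum.distrib[symmetric]
  by (intro sum.cong; simp; blast)+

lemma all_rows_lt:
  assumes "all_rows i j k l"
  shows "r < 4 \<longleftrightarrow> r = i \<or> r = j \<or> r = k \<or> r = l"
proof -
  have "r < 4 \<longleftrightarrow> r \<in> {0..<4}" by simp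
  then show ?thesis using assms unfolding all_rows_def by simp
qed

lemma nearest_rows:
  assumes "all_rows i j k l"
  shows "nearest c K y \<subseteq> {i, j, k, l}"
  by (auto simp: nearest_def all_rows_lt[OF assms])

lemma all_rows_swap:
  assumes "all_rows i j k l"
  shows "all_rows j i k l"
  using assms unfolding all_rows_def by auto

lemma all_rows_distinct:
  assumes "all_rows i j k l"
  shows "i \<noteq> j" "i \<noteq> k" "i \<noteq> l" "j \<noteq> k" "j \<noteq> l" "k \<noteq> l"
    "j \<noteq> i" "k \<noteq> i" "l \<noteq> i" "k \<noteq> j" "l \<noteq> j" "l \<noteq> k"
  using assms unfolding all_rows_def by auto

text \<open>
  A midpoint of \<open>i\<close> and \<open>j\<close> that is not closer to \<open>k\<close> or \<open>l\<close> does it, since by parity \<open>k\<close> and \<open>l\<close> cannot tie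
  with \<open>i\<close>. Lone columns at \<open>j\<close> are the best ones to change, because doing so moves away from \<open>k\<close> and \<open>l\<close>; lone
  columns at \<open>i\<close> move towards both and are left alone. This works if the former are at least as many as
  the latter, which holds for \<open>i, j\<close> or for \<open>j, i\<close>.
\<close>

lemma two_two_tie_if_lone_le:
  assumes fin: "finite K" and rows: "all_rows i j k l"
    and even: "even_dist c K i j" "\<not> even_dist c K i k" "\<not> even_dist c K i l"
    and x0: "x0 \<in> K" "\<not> (c i x0 = c j x0 \<and> c i x0 = c k x0 \<and> c i x0 = c l x0)"
      "\<not> (c i x0 \<noteq> c j x0 \<and> c k x0 \<noteq> c l x0)"
    and le: "pattern_count c K i j k l True True True \<le> pattern_count c K i j k l True False False"
  obtains y where "y \<subseteq> K" "nearest c K y = {i, j}"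
proof -
  let ?N = "pattern_count c K i j k l"
  let ?F = "\<lambda>p q r. {x \<in> K. (c i x \<noteq> c j x) = p \<and> (c i x \<noteq> c k x) = q \<and> (c i x \<noteq> c l x) = r}"
  note D = card_diff_cols_pattern[OF fin, where c = c and i = i and j = j and k = k and l = l]
  obtain t where t: "card (diff_cols c K i j) = 2 * t"
    using even(1) unfolding even_dist_def by (elim evenE)
  have "\<exists>p q r. x0 \<in> ?F p q r \<and> (p, q, r) \<in>
      {(True, False, False), (True, True, True), (False, True, True), (False, True, False), (False, False, True)}"
    using x0 by auto
  then have nz: "\<not> (?N True False False = 0 \<and> ?N True True True = 0 \<and> ?N False True True = 0 \<and>
      ?N False True False = 0 \<and> ?N False False True = 0)"
    using fin unfolding pattern_count_def by (auto simp del: not_False_eq_True)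
  obtain a' b' g' where s: "a' \<le> ?N True False False" "b' \<le> ?N True False True" "g' \<le> ?N True True False"
    "a' + b' + g' = t" "2 * g' \<le> card (diff_cols c K i k)" "2 * b' \<le> card (diff_cols c K i l)"
  proof (rule midpoint_sizes[OF _ _ _ le nz])
    show "?N True False False + ?N True False True + ?N True True False + ?N True True True = 2 * t"
      using D(1) t by simp
    have "?N True True False + ?N True True True + ?N False True True + ?N False True False =
        card (diff_cols c K i k)" using D(2) by simp
    then show "odd (?N True True False + ?N True True True + ?N False True True + ?N False True False)"
      using even(2) by (simp only: even_dist_def not_False_eq_True)
    have "?N True False True + ?N True True True + ?N False True True + ?N False False True =
        card (diff_cols c K i l)" using D(3) by simp
    then show "odd (?N True False True + ?N True True True + ?N False True True + ?N False False True)"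
      using even(3) by (simp only: even_dist_def not_False_eq_True)
  qed (use D that in \<open>auto simp: ac_simps\<close>)
  obtain A where A: "A \<subseteq> ?F True False False" "card A = a'" "finite A"
    using s(1) unfolding pattern_count_def by (rule obtain_subset_with_card_n)
  obtain B where B: "B \<subseteq> ?F True False True" "card B = b'" "finite B"
    using s(2) unfolding pattern_count_def by (rule obtain_subset_with_card_n)
  obtain G where G: "G \<subseteq> ?F True True False" "card G = g'" "finite G"
    using s(3) unfolding pattern_count_def by (rule obtain_subset_with_card_n)
  define S where "S = A \<union> B \<union> G"
  have "card S = card (A \<union> B) + card G"
    unfolding S_def using A B G by (intro card_Un_disjoint) auto
  also have "card (A \<union> B) = card A + card B"
    using A B by (intro card_Un_disjoint) auto
  finally have cS: "card S = t" using A B G s by simp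
  have SK: "S \<subseteq> K" unfolding S_def using A B G by auto
  have cut: "S \<inter> diff_cols c K i i = {}" "S \<inter> diff_cols c K i j = S"
     "S \<inter> diff_cols c K i k = G" "S \<inter> diff_cols c K i l = B"
    unfolding S_def diff_cols_def using A B G by auto
  let ?y = "flip_in_row c K i S"
  note wd = word_dist_flip[OF fin SK, of c _ i]
  have di: "word_dist c K i ?y = t" using wd[of i] cS cut by (simp add: diff_cols_def)
  moreover have dj: "word_dist c K j ?y = t" using wd[of j] cS cut t by simp
  moreover have "t \<le> word_dist c K k ?y" using wd[of k] cS cut G s by simp
  moreover have "t \<le> word_dist c K l ?y" using wd[of l] cS cut B s by simp
  ultimately have "i \<in> nearest c K ?y" "j \<in> nearest c K ?y"
    by (auto simp: nearest_def all_rows_lt[OF rows])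
  moreover from this(1) have "k \<notin> nearest c K ?y" "l \<notin> nearest c K ?y"
    using even_dist_if_nearest[OF fin] even by blast+
  ultimately have "nearest c K ?y = {i, j}"
    using nearest_rows[OF rows, of c K ?y] by blast
  then show thesis by (rule that[OF flip_in_row_subset])
qed

text \<open>
  The hypothesis on \<open>x0\<close> cannot be dropped: if only the pairings \<open>ik|jl\<close> and \<open>il|jk\<close> occur, both an odd
  number of times, then each midpoint of \<open>i\<close> and \<open>j\<close> is closer to \<open>k\<close> or \<open>l\<close>, and no ties exist at all.
\<close>

lemma two_two_tie:
  assumes fin: "finite K" and rows: "all_rows i j k l"
    and even: "even_dist c K i j" "\<not> even_dist c K i k" "\<not> even_dist c K i l"
    and x0: "x0 \<in> K" "\<not> (c i x0 = c j x0 \<and> c i x0 = c k x0 \<and> c i x0 = c l x0)"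
      "\<not> (c i x0 \<noteq> c j x0 \<and> c k x0 \<noteq> c l x0)"
  obtains y where "y \<subseteq> K" "nearest c K y = {i, j}"
proof (cases "pattern_count c K i j k l True True True \<le> pattern_count c K i j k l True False False")
  case True
  then show thesis using two_two_tie_if_lone_le[OF assms] that by blast
next
  case False
  have "pattern_count c K j i k l True True True = pattern_count c K i j k l True False False"
    "pattern_count c K j i k l True False False = pattern_count c K i j k l True True True"
    unfolding pattern_count_def by (auto intro!: arg_cong[where f = card])
  then have "pattern_count c K j i k l True True True \<le> pattern_count c K j i k l True False False"
    using False by simp
  moreover obtain f :: "nat \<Rightarrow> bool" where "\<forall>r s. even_dist c K r s \<longleftrightarrow> f r = f s"
    by (rule even_dist_colouring[OF fin, where c = c])
  note f = this[rule_format]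
  have "even_dist c K j i" "\<not> even_dist c K j k" "\<not> even_dist c K j l"
    using even unfolding f by blast+
  moreover have "\<not> (c j x0 = c i x0 \<and> c j x0 = c k x0 \<and> c j x0 = c l x0)"
      "\<not> (c j x0 \<noteq> c i x0 \<and> c k x0 \<noteq> c l x0)"
    using x0 by auto
  ultimately obtain y where "y \<subseteq> K" "nearest c K y = {j, i}"
    using two_two_tie_if_lone_le[OF fin all_rows_swap[OF rows] _ _ _ x0(1)] by blast
  then show thesis by (intro that[of y]) auto
qed

section \<open>Codes with a column distinguishing a single row\<close>

definition lone :: "(nat \<Rightarrow> nat \<Rightarrow> bool) \<Rightarrow> nat \<Rightarrow> nat \<Rightarrow> bool" where
  "lone c x i \<longleftrightarrow> (\<forall>r<4. r \<noteq> i \<longrightarrow> c r x \<noteq> c i x)"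

definition const_col :: "(nat \<Rightarrow> nat \<Rightarrow> bool) \<Rightarrow> nat \<Rightarrow> bool" where
  "const_col c x \<longleftrightarrow> (\<forall>r<4. \<forall>s<4. c r x = c s x)"

lemma splitsI: "r \<in> A \<Longrightarrow> s \<in> A \<Longrightarrow> b r \<noteq> b s \<Longrightarrow> splits b A"
  by (auto simp: splits_def)

lemma nearest_subset: "nearest c K y \<subseteq> {0..<4}"
  by (auto simp: nearest_def)

lemma splits_lone:
  assumes "lone c x i" "splits (\<lambda>r. c r x) (nearest c' K y)"
  obtains r where "i \<in> nearest c' K y" "r \<in> nearest c' K y" "r \<noteq> i" "r < 4"
proof -
  obtain r s where *: "r \<in> nearest c' K y" "s \<in> nearest c' K y" "c r x \<noteq> c s x"
    using assms(2) by (auto simp: splits_def)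
  moreover have "r < 4" "s < 4" using * nearest_subset by force+
  ultimately consider "r = i" "s \<noteq> i" | "s = i" "r \<noteq> i"
    using assms(1) unfolding lone_def by blast
  then show thesis
    by cases (use that[of r] that[of s] * \<open>r < 4\<close> \<open>s < 4\<close> in simp_all)
qed

text \<open>
  All columns except \<open>x\<close> are of the form \<open>ij|kl\<close> or \<open>il|jk\<close>, both an odd number of times, and \<open>ij|kl\<close> occurs at least
  twice. Exchange one \<open>ij|kl\<close> for \<open>ik|jl\<close>. Only words whose set of nearest rows is \<open>{i, k}\<close> could get lost (a tie of
  \<open>j\<close> and \<open>l\<close> is excluded by parity). There are none: with \<open>N\<close> columns left, rows \<open>i\<close> and \<open>k\<close> are complementary, so
  a tie puts both at distance \<open>N / 2\<close>, while \<open>j\<close> and \<open>l\<close> disagree everywhere except in \<open>x\<close>, so the sum of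
  their distances is at most \<open>N + 1\<close>. A word with nearest rows \<open>{i, j}\<close> is gained.
\<close>

lemma lone_with_repeated_pairing_beaten:
  assumes fin: "finite K" and rows: "all_rows i j k l"
    and x: "x \<in> K" "lone c x i"
    and pairs: "\<And>z. z \<in> K - {x} \<Longrightarrow> c i z \<noteq> c k z \<and> c j z \<noteq> c l z"
    and odd: "\<not> even_dist c (K - {x}) i j" "\<not> even_dist c (K - {x}) i l"
    and two: "2 \<le> card {z \<in> K - {x}. c i z = c j z}"
  shows "beaten c K"
proof -
  note d = all_rows_distinct[OF rows]
  note lt = all_rows_lt[OF rows]
  have lx: "c j x \<noteq> c i x" "c k x \<noteq> c i x" "c l x \<noteq> c i x"
    using x(2) d unfolding lone_def lt by auto
  let ?P = "{z \<in> K - {x}. c i z = c j z}" and ?Q = "{z \<in> K - {x}. c i z \<noteq> c j z}"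
  obtain x2 where x2: "x2 \<in> K" "x2 \<noteq> x" "c i x2 = c j x2"
  proof -
    have "?P \<noteq> {}"
    proof
      assume "?P = {}"
      then have "card ?P = 0" by (simp only: card.empty)
      then show False using two by linarith
    qed
    then show thesis using that by blast
  qed
  have x2': "c i x2 \<noteq> c k x2" "c j x2 \<noteq> c l x2" using pairs[of x2] x2 by auto
  let ?K = "K - {x2}"
  let ?b = "\<lambda>r. r = i \<or> r = k"
  have finK: "finite ?K" and xK: "x \<in> ?K" using fin x x2 by auto
  have PQ: "K - {x} = ?P \<union> ?Q" by auto
  have cPQ: "card (K - {x}) = card ?P + card ?Q"
    by (subst PQ, rule card_Un_disjoint) (use fin in auto)
  then have cK: "card ?K = card ?P + card ?Q"
    using fin x x2 by simp
  have "diff_cols c (K - {x}) i j = ?Q" by (auto simp: diff_cols_def)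
  then have oddQ: "odd (card ?Q)" using odd(1) by (simp add: even_dist_def)
  have Dik: "diff_cols c ?K i k = ?K" using pairs lx by (fastforce simp: diff_cols_def)
  have Djl: "diff_cols c ?K j l = ?K - {x}" using pairs lx by (fastforce simp: diff_cols_def)
  have Dij: "diff_cols c ?K i j = insert x ?Q" using x x2 lx by (auto simp: diff_cols_def)
  have jl: "\<not> even_dist c ?K j l"
  proof -
    obtain f :: "nat \<Rightarrow> bool" where "\<forall>r s. even_dist c (K - {x}) r s \<longleftrightarrow> f r = f s"
      by (rule even_dist_colouring[OF finite_Diff[OF fin], where c = c])
    note f = this[rule_format]
    have "even_dist c (K - {x}) j l" using odd unfolding f by blast
    then have "even_dist c K j l" using even_dist_remove[OF fin x(1), of c j l] lx by auto
    then show ?thesis using even_dist_remove[OF fin x2(1), of c j l] x2' by auto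
  qed
  have not_ik: False if y: "nearest c ?K y = {i, k}" for y
  proof -
    let ?m = "min_dist c ?K y"
    have "word_dist c ?K i y + word_dist c ?K k y = card ?K +
        2 * card {z \<in> ?K. c i z \<noteq> (z \<in> y) \<and> c k z \<noteq> (z \<in> y)}"
      unfolding word_dist_add[OF finK] Dik ..
    moreover have none: "{z \<in> ?K. c i z \<noteq> (z \<in> y) \<and> c k z \<noteq> (z \<in> y)} = {}"
      using Dik unfolding diff_cols_def by blast
    moreover have "i \<in> nearest c ?K y" "k \<in> nearest c ?K y" using y by auto
    ultimately have m: "2 * ?m = card ?K" unfolding none by (simp add: nearest_iff)
    have "word_dist c ?K j y + word_dist c ?K l y = card (?K - {x}) +
        2 * card {z \<in> ?K. c j z \<noteq> (z \<in> y) \<and> c l z \<noteq> (z \<in> y)}"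
      unfolding word_dist_add[OF finK] Djl ..
    moreover have "card {z \<in> ?K. c j z \<noteq> (z \<in> y) \<and> c l z \<noteq> (z \<in> y)} \<le> card {x}"
      using Djl unfolding diff_cols_def by (intro card_mono) blast+
    moreover have "card (?K - {x}) + 1 = card ?K" using card_Suc_Diff1[OF finK xK] by simp
    ultimately have sum: "word_dist c ?K j y + word_dist c ?K l y \<le> card ?K + 1" by simp
    have "?m < word_dist c ?K r y" if "r = j \<or> r = l" for r
    proof -
      have "r \<notin> nearest c ?K y" "r < 4" using that y d by (auto simp: lt)
      then show ?thesis using min_dist_le[of r c ?K y] by (auto simp: nearest_iff)
    qed
    from this[of j] this[of l] show False using sum m by auto
  qed
  \<comment> \<open>The gained word is a midpoint of \<open>i\<close> and \<open>j\<close> that agrees with \<open>i\<close> in column \<open>x\<close>; the remaining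
    columns \<open>ij|kl\<close> keep \<open>k\<close> and \<open>l\<close> further away.\<close>
  have card_Q: "card (insert x ?Q) = card ?Q + 1" using fin by simp
  have "even (card ?Q + 1)" using oddQ by simp
  then obtain t where t: "card ?Q + 1 = 2 * t" by (rule evenE)
  then have "t \<le> card ?Q" using oddQ by (cases "card ?Q") auto
  then obtain S where S: "S \<subseteq> ?Q" "card S = t" "finite S" by (rule obtain_subset_with_card_n)
  then have SK: "S \<subseteq> ?K" using x2 by auto
  let ?y = "flip_in_row c ?K i S"
  note wd = word_dist_flip[OF finK SK, of c _ i]
  have "S \<inter> diff_cols c ?K i j = S" "S \<inter> diff_cols c ?K i k = S" "S \<inter> diff_cols c ?K i i = {}"
    using S SK unfolding Dij Dik by (auto simp: diff_cols_def)
  moreover have "S \<inter> diff_cols c ?K i l = {}"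
    using S pairs lx by (fastforce simp: diff_cols_def)
  moreover have "card ?P - 1 + 1 \<le> card (diff_cols c ?K i l)"
  proof -
    have "diff_cols c ?K i l \<supseteq> insert x (?P - {x2})" using pairs lx x x2 by (fastforce simp: diff_cols_def)
    then have "card (insert x (?P - {x2})) \<le> card (diff_cols c ?K i l)"
      using fin by (intro card_mono) (auto simp: diff_cols_def)
    then show ?thesis using x2 fin by simp
  qed
  ultimately have w: "word_dist c ?K i ?y = t" "word_dist c ?K j ?y = t"
    "t < word_dist c ?K k ?y" "t < word_dist c ?K l ?y"
    using wd[of i] wd[of j] wd[of k] wd[of l] S t two card_Q cK
    unfolding Dij Dik by (auto simp: diff_cols_def)
  then have ynear: "nearest c ?K ?y = {i, j}"
    by (auto simp: nearest_def lt)
  show ?thesis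
  proof (rule beaten_by_set_column[OF fin x2(1), where b = ?b and y = ?y])
    fix y assume sp: "splits (\<lambda>r. c r x2) (nearest c ?K y)"
    show "splits ?b (nearest c ?K y)"
    proof (rule ccontr)
      assume ns: "\<not> splits ?b (nearest c ?K y)"
      note sub = nearest_rows[OF rows, of c ?K y]
      have "nearest c ?K y = {i, k} \<or> (j \<in> nearest c ?K y \<and> l \<in> nearest c ?K y)"
        using sp ns sub d unfolding splits_def by blast
      then show False using not_ik even_dist_if_nearest[OF finK] jl by blast
    qed
  qed (use ynear d x2 in \<open>auto simp: splits_def\<close>)
qed

text \<open>
  One of the two pairings is repeated, since there are at least three of these columns.
\<close>

lemma lone_with_both_pairings_beaten:
  assumes fin: "finite K" and rows: "all_rows i j k l" and n: "4 \<le> card K"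
    and x: "x \<in> K" "lone c x i"
    and pairs: "\<And>z. z \<in> K - {x} \<Longrightarrow> c i z \<noteq> c k z \<and> c j z \<noteq> c l z"
    and odd: "\<not> even_dist c (K - {x}) i j" "\<not> even_dist c (K - {x}) i l"
  shows "beaten c K"
proof -
  let ?P = "{z \<in> K - {x}. c i z = c j z}" and ?Q = "{z \<in> K - {x}. c i z = c l z}"
  have PQ: "K - {x} = ?P \<union> ?Q" using pairs by auto
  have "card (K - {x}) \<le> card ?P + card ?Q"
    by (subst PQ, rule card_Un_le)
  then have "2 \<le> card ?P \<or> 2 \<le> card ?Q" using n fin x by auto
  then show ?thesis
  proof
    assume "2 \<le> card ?P"
    then show ?thesis using lone_with_repeated_pairing_beaten[OF fin rows x pairs odd] by blast
  next
    assume "2 \<le> card ?Q"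
    moreover have "all_rows i l k j" using rows unfolding all_rows_def by auto
    ultimately show ?thesis
      using lone_with_repeated_pairing_beaten[OF fin _ x _ odd(2,1)] pairs by auto
  qed
qed

text \<open>
  If \<open>i\<close> can only tie with \<open>k\<close>, then the pairing \<open>ij|kl\<close> splits all that the lone column at \<open>i\<close> splits, and in
  addition the words with nearest rows \<open>{j, l}\<close>.
\<close>

lemma lone_column_two_two_beaten:
  assumes fin: "finite K" and rows: "all_rows i j k l" and n: "4 \<le> card K"
    and x: "x \<in> K" "lone c x i"
    and nonconst: "\<And>z. z \<in> K \<Longrightarrow> \<not> const_col c z"
    and even: "even_dist c (K - {x}) i k" "\<not> even_dist c (K - {x}) i j" "\<not> even_dist c (K - {x}) i l"
  shows "beaten c K"
proof (cases "\<exists>z\<in>K - {x}. \<not> (c j z \<noteq> c l z \<and> c i z \<noteq> c k z)")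
  case True
  note lt = all_rows_lt[OF rows] and d = all_rows_distinct[OF rows]
  have fin': "finite (K - {x})" using fin by simp
  obtain z where z: "z \<in> K - {x}" "\<not> (c j z \<noteq> c l z \<and> c i z \<noteq> c k z)" using True by blast
  have rows': "all_rows j l i k" using rows unfolding all_rows_def by auto
  obtain f :: "nat \<Rightarrow> bool" where "\<forall>r s. even_dist c (K - {x}) r s \<longleftrightarrow> f r = f s"
    by (rule even_dist_colouring[OF fin', where c = c])
  note f = this[rule_format]
  have even': "even_dist c (K - {x}) j l" "\<not> even_dist c (K - {x}) j i" "\<not> even_dist c (K - {x}) j k"
    using even unfolding f by blast+
  have z': "\<not> (c j z = c l z \<and> c j z = c i z \<and> c j z = c k z)"
    using nonconst[of z] z(1) unfolding const_col_def lt by blast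
  obtain y where y: "y \<subseteq> K - {x}" "nearest c (K - {x}) y = {j, l}"
    by (rule two_two_tie[OF fin' rows' even' z(1) z' z(2)])
  show ?thesis
  proof (rule beaten_by_set_column[OF fin x(1) _ y(1), where b = "\<lambda>r. r = i \<or> r = j"])
    fix y assume "splits (\<lambda>r. c r x) (nearest c (K - {x}) y)"
    then obtain r where r: "i \<in> nearest c (K - {x}) y" "r \<in> nearest c (K - {x}) y" "r \<noteq> i" "r < 4"
      by (rule splits_lone[OF x(2)])
    then have "r = k" using even_dist_if_nearest[OF fin' r(1,2)] even unfolding lt by blast
    then show "splits (\<lambda>r. r = i \<or> r = j) (nearest c (K - {x}) y)"
      using r d unfolding splits_def by blast
  qed (use y d x(2) in \<open>auto simp: splits_def lone_def lt\<close>)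
next
  case False
  then show ?thesis using lone_with_both_pairings_beaten[OF fin rows n x _ even(2,3)] by blast
qed

text \<open>
  Row \<open>i\<close> ties with no other row, so the lone column splits nothing, while the other rows do tie somewhere.
\<close>

lemma lone_column_isolated_row_beaten:
  assumes fin: "finite K" and rows: "all_rows i j k l" and x: "x \<in> K" "lone c x i"
    and odd: "\<not> even_dist c (K - {x}) i j" "\<not> even_dist c (K - {x}) i k" "\<not> even_dist c (K - {x}) i l"
  shows "beaten c K"
proof -
  note lt = all_rows_lt[OF rows] and d = all_rows_distinct[OF rows]
  have fin': "finite (K - {x})" using fin by simp
  have i_odd: "\<not> even_dist c (K - {x}) i r" if "r < 4" "r \<noteq> i" for r
    using that odd unfolding lt by auto
  obtain f :: "nat \<Rightarrow> bool" where "\<forall>r s. even_dist c (K - {x}) r s \<longleftrightarrow> f r = f s"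
    by (rule even_dist_colouring[OF fin', where c = c])
  note f = this[rule_format]
  have "even_dist c (K - {x}) r s" if "r < 4" "s < 4" "r \<noteq> i" "s \<noteq> i" for r s
    using i_odd[of r] i_odd[of s] that unfolding f by blast
  then obtain y r s where y: "y \<subseteq> K - {x}" "r \<noteq> s" "r \<noteq> i" "s \<noteq> i"
      "r \<in> nearest c (K - {x}) y" "s \<in> nearest c (K - {x}) y"
    using three_even_rows_tie[OF fin', of i c] by blast
  have none: "\<not> splits (\<lambda>r. c r x) (nearest c (K - {x}) y)" for y
  proof
    assume "splits (\<lambda>r. c r x) (nearest c (K - {x}) y)"
    then obtain r where "i \<in> nearest c (K - {x}) y" "r \<in> nearest c (K - {x}) y" "r \<noteq> i" "r < 4"
      by (rule splits_lone[OF x(2)])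
    then show False using even_dist_if_nearest[OF fin'] i_odd by blast
  qed
  have "splits (\<lambda>z. z = r) (nearest c (K - {x}) y)"
    by (rule splitsI[OF y(5,6)]) (use y(2) in simp)
  then show ?thesis using beaten_by_set_column[OF fin x(1) _ y(1)] none by blast
qed

lemma beaten_if_set_column_beaten:
  assumes "finite K" "x \<in> K" "beaten (set_column c x b) K"
    and "\<And>y. y \<subseteq> K - {x} \<Longrightarrow> splits (\<lambda>r. c r x) (nearest c (K - {x}) y) \<Longrightarrow>
            splits b (nearest c (K - {x}) y)"
  shows "beaten c K"
  using assms(3) weight_set_column_le[OF assms(1,2) _ _ assms(4)]
  unfolding beaten_def by (meson order_le_less_trans)

text \<open>
  Without the lone column at \<open>j\<close>, the parity classes are \<open>{i, j}\<close> and \<open>{k, l}\<close>.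
\<close>

lemma two_lone_rows_beaten_even:
  assumes fin: "finite K" and rows: "all_rows i j k l" and n: "4 \<le> card K"
    and x: "x \<in> K" "lone c x i"
    and nonconst: "\<And>z. z \<in> K \<Longrightarrow> \<not> const_col c z"
    and even: "even_dist c (K - {x}) i j" "even_dist c (K - {x}) i k" "even_dist c (K - {x}) i l"
    and x': "x' \<in> K" "lone c x' j"
  shows "beaten c K"
proof (rule lone_column_two_two_beaten[OF fin _ n x' nonconst])
  note lt = all_rows_lt[OF rows] and d = all_rows_distinct[OF rows]
  have fin': "finite (K - {x})" using fin by simp
  show "all_rows j k i l" using rows unfolding all_rows_def by auto
  have lx: "c j x \<noteq> c i x" "c k x \<noteq> c i x" "c l x \<noteq> c i x"
    using x(2) d unfolding lone_def lt by auto
  have lx': "c i x' \<noteq> c j x'" "c k x' \<noteq> c j x'" "c l x' \<noteq> c j x'"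
    using x'(2) d unfolding lone_def lt by auto
  obtain f :: "nat \<Rightarrow> bool" where "\<forall>r s. even_dist c (K - {x}) r s \<longleftrightarrow> f r = f s"
    by (rule even_dist_colouring[OF fin', where c = c])
  note f = this[rule_format]
  have K: "\<not> even_dist c K j i" "even_dist c K j k" "even_dist c K j l"
    unfolding even_dist_remove[OF fin x(1)] using lx even unfolding f by auto
  show "even_dist c (K - {x'}) j i" "\<not> even_dist c (K - {x'}) j k" "\<not> even_dist c (K - {x'}) j l"
    using even_dist_remove[OF fin x'(1), of c] lx' K by blast+
qed

text \<open>
  Since \<open>i\<close> and \<open>j\<close> do not tie, the lone column \<open>x\<close> may be exchanged for \<open>ij|kl\<close>. Afterwards \<open>i\<close> is alone in its
  parity class; deleting a lone column at \<open>i'\<close> makes the classes \<open>{i, i'}\<close> and the two other rows.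
\<close>

lemma two_lone_rows_beaten_three_one:
  assumes fin: "finite K" and rows: "all_rows i j k l" and n: "4 \<le> card K"
    and x: "x \<in> K" "lone c x i"
    and nonconst: "\<And>z. z \<in> K \<Longrightarrow> \<not> const_col c z"
    and even: "\<not> even_dist c (K - {x}) i j" "even_dist c (K - {x}) i k" "even_dist c (K - {x}) i l"
    and x': "x' \<in> K" "i' < 4" "i' \<noteq> i" "lone c x' i'"
  shows "beaten c K"
proof -
  note lt = all_rows_lt[OF rows] and d = all_rows_distinct[OF rows]
  have fin': "finite (K - {x})" using fin by simp
  have lx: "c j x \<noteq> c i x" "c k x \<noteq> c i x" "c l x \<noteq> c i x"
    using x(2) d unfolding lone_def lt by auto
  have ne: "x' \<noteq> x"
  proof
    assume "x' = x"
    then have "\<forall>r<4. r \<noteq> i' \<longrightarrow> c r x \<noteq> c i' x" using x'(4) by (simp add: lone_def)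
    then show False using x'(2,3) lx d unfolding lt by auto
  qed
  let ?b = "\<lambda>r. r = i \<or> r = j"
  define c1 where "c1 = set_column c x ?b"
  have c1x: "c1 r x = ?b r" "z \<noteq> x \<Longrightarrow> c1 r z = c r z" for r z
    by (auto simp: c1_def set_column_def)
  have "even_dist c1 K r s \<longleftrightarrow> (even_dist c (K - {x}) r s \<noteq> (?b r \<noteq> ?b s))" for r s
    using even_dist_remove[OF fin x(1), of c1 r s] by (simp add: c1x) (simp add: c1_def)
  then have K: "\<not> even_dist c1 K i r" if "r < 4" "r \<noteq> i" for r
    using that d even unfolding lt by auto
  obtain f :: "nat \<Rightarrow> bool" where "\<forall>r s. even_dist c1 K r s \<longleftrightarrow> f r = f s"
    by (rule even_dist_colouring[OF fin, where c = c1])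
  note f = this[rule_format]
  have lone1: "lone c1 x' i'" using x'(4) ne by (simp add: lone_def c1x)
  have eqv: "even_dist c1 (K - {x'}) i' r \<longleftrightarrow> r = i" if "r < 4" "r \<noteq> i'" for r
  proof -
    have "c1 r x' \<noteq> c1 i' x'" using lone1 that by (simp add: lone_def)
    then have "even_dist c1 (K - {x'}) i' r \<longleftrightarrow> \<not> even_dist c1 K i' r"
      using even_dist_remove[OF fin x'(1), of c1 i' r] by blast
    also have "\<dots> \<longleftrightarrow> r = i"
      using K[of i'] K[of r] that x'(2,3) unfolding f by blast
    finally show ?thesis .
  qed
  obtain u v where uv: "all_rows i' u i v"
  proof -
    consider "i' = j" | "i' = k" | "i' = l" using x'(2,3) unfolding lt by blast
    then show thesis
    proof cases
      case 1
      show thesis by (rule that[of k l]) (use rows 1 in \<open>auto simp: all_rows_def\<close>)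
    next
      case 2
      show thesis by (rule that[of j l]) (use rows 2 in \<open>auto simp: all_rows_def\<close>)
    next
      case 3
      show thesis by (rule that[of j k]) (use rows 3 in \<open>auto simp: all_rows_def\<close>)
    qed
  qed
  have "beaten c1 K"
  proof (rule lone_column_two_two_beaten[OF fin uv n x'(1) lone1])
    show "\<not> const_col c1 z" if "z \<in> K" for z
    proof (cases "z = x")
      case True
      have "c1 i x \<noteq> c1 k x" using d by (simp add: c1x)
      then show ?thesis using True unfolding const_col_def lt by blast
    next
      case False
      then show ?thesis using nonconst[OF that] by (simp add: const_col_def c1x)
    qed
  qed (use eqv all_rows_distinct[OF uv] in \<open>auto simp: all_rows_lt[OF uv]\<close>)
  then show ?thesis unfolding c1_def
  proof (rule beaten_if_set_column_beaten[OF fin x(1)])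
    fix y assume "splits (\<lambda>r. c r x) (nearest c (K - {x}) y)"
    then obtain r where r: "i \<in> nearest c (K - {x}) y" "r \<in> nearest c (K - {x}) y" "r \<noteq> i" "r < 4"
      by (rule splits_lone[OF x(2)])
    then have "r \<noteq> j" using even_dist_if_nearest[OF fin'] even by blast
    then show "splits ?b (nearest c (K - {x}) y)"
      by (intro splitsI[OF r(1,2)]) (use r(3) in simp)
  qed
qed

section \<open>Codes that cannot be improved\<close>

lemma parity_classes:
  assumes fin: "finite K"
  obtains (three) k where "\<And>r s. r < 4 \<Longrightarrow> s < 4 \<Longrightarrow> r \<noteq> k \<Longrightarrow> s \<noteq> k \<Longrightarrow> even_dist c K r s"
  | (two_two) i j k l where "all_rows i j k l"
      "even_dist c K i j" "\<not> even_dist c K i k" "\<not> even_dist c K i l"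
proof -
  obtain f :: "nat \<Rightarrow> bool" where "\<forall>r s. even_dist c K r s \<longleftrightarrow> f r = f s"
    by (rule even_dist_colouring[OF fin, where c = c])
  note E = this[rule_format]
  have lt: "r < 4 \<longleftrightarrow> r = 0 \<or> r = 1 \<or> r = 2 \<or> r = 3" for r :: nat by auto
  have rows: "all_rows 0 1 2 3" "all_rows 0 2 1 3" "all_rows 0 3 1 2"
    by (auto simp: all_rows_def)
  consider "f 1 = f 2" "f 2 = f 3" | "f 0 = f 1" "f 1 = f 2" | "f 0 = f 1" "f 1 = f 3"
    | "f 0 = f 2" "f 2 = f 3" | "f 0 = f 1" "f 0 \<noteq> f 2" "f 0 \<noteq> f 3"
    | "f 0 = f 2" "f 0 \<noteq> f 1" "f 0 \<noteq> f 3" | "f 0 = f 3" "f 0 \<noteq> f 1" "f 0 \<noteq> f 2" by blast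
  then show thesis
  proof cases
    case 1 then show thesis by (intro three[of 0]) (auto simp: lt E)
  next
    case 2 then show thesis by (intro three[of 3]) (auto simp: lt E)
  next
    case 3 then show thesis by (intro three[of 2]) (auto simp: lt E)
  next
    case 4 then show thesis by (intro three[of 1]) (auto simp: lt E)
  next
    case 5 then show thesis by (intro two_two[OF rows(1)]) (simp_all add: E)
  next
    case 6 then show thesis by (intro two_two[OF rows(2)]) (simp_all add: E)
  next
    case 7 then show thesis by (intro two_two[OF rows(3)]) (simp_all add: E)
  qed
qed

text \<open>
  Exactly the constant columns and the pairings satisfy the equation. If only one pairing occurred, then
  one of the rows \<open>j\<close>, \<open>k\<close>, \<open>l\<close> would coincide with row \<open>i\<close>.
\<close>

definition linear_form :: "(nat \<Rightarrow> nat \<Rightarrow> bool) \<Rightarrow> nat set \<Rightarrow> bool" where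
  "linear_form c K \<longleftrightarrow> (\<exists>i j k l. all_rows i j k l \<and>
     (\<forall>x\<in>K. (c i x = c j x) = (c k x = c l x)) \<and>
     diff_cols c K i j \<noteq> {} \<and> diff_cols c K i k \<noteq> {} \<and> diff_cols c K i l \<noteq> {})"

text \<open>
  A constant column may be exchanged for any other one, so any tie in the rest of the code is enough. A code
  without ties has two parity classes of two rows, and \<open>two_two_tie\<close> leaves only linear codes.
\<close>

lemma const_column_linear_or_beaten:
  assumes fin: "finite K" and x: "x \<in> K" "const_col c x"
  shows "linear_form c K \<or> beaten c K"
proof -
  have fin': "finite (K - {x})" using fin by simp
  have none: "\<not> splits (\<lambda>r. c r x) (nearest c (K - {x}) y)" for y
  proof
    assume "splits (\<lambda>r. c r x) (nearest c (K - {x}) y)"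
    then obtain r s where rs: "r \<in> nearest c (K - {x}) y" "s \<in> nearest c (K - {x}) y" "c r x \<noteq> c s x"
      unfolding splits_def by blast
    then have "r < 4" "s < 4" by (simp_all add: nearest_def)
    then have "c r x = c s x" using x(2) unfolding const_col_def by blast
    then show False using rs(3) by contradiction
  qed
  have tie: "beaten c K" if "y \<subseteq> K - {x}" "r \<in> nearest c (K - {x}) y" "s \<in> nearest c (K - {x}) y" "r \<noteq> s"
    for y r s
  proof (rule beaten_by_set_column[OF fin x(1) _ that(1) _ none])
    show "splits (\<lambda>z. z = r) (nearest c (K - {x}) y)"
      by (rule splitsI[OF that(2,3)]) (use that(4) in simp)
  qed (use none in auto)
  show ?thesis
  proof (rule parity_classes[OF fin', of c])
    fix k :: nat
    assume three: "\<And>r s. r < 4 \<Longrightarrow> s < 4 \<Longrightarrow> r \<noteq> k \<Longrightarrow> s \<noteq> k \<Longrightarrow> even_dist c (K - {x}) r s"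
    obtain y r s where y: "y \<subseteq> K - {x}" "r \<noteq> s" "r \<noteq> k" "s \<noteq> k"
        "r \<in> nearest c (K - {x}) y" "s \<in> nearest c (K - {x}) y"
      by (rule three_even_rows_tie[OF fin' three])
    show ?thesis using tie[OF y(1,5,6,2)] by (rule disjI2)
  next
    fix i j k l
    assume two_two: "all_rows i j k l" "even_dist c (K - {x}) i j"
      "\<not> even_dist c (K - {x}) i k" "\<not> even_dist c (K - {x}) i l"
    show ?thesis
    proof (rule disjCI)
      assume nb: "\<not> beaten c K"
      have cols: "(c i z = c j z \<and> c i z = c k z \<and> c i z = c l z) \<or> (c i z \<noteq> c j z \<and> c k z \<noteq> c l z)"
        if "z \<in> K - {x}" for z
      proof (rule ccontr)
        assume *: "\<not> ?thesis"
        have 1: "\<not> (c i z = c j z \<and> c i z = c k z \<and> c i z = c l z)"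
          and 2: "\<not> (c i z \<noteq> c j z \<and> c k z \<noteq> c l z)" using * by blast+
        obtain y where y: "y \<subseteq> K - {x}" "nearest c (K - {x}) y = {i, j}"
          by (rule two_two_tie[OF fin' two_two \<open>z \<in> K - {x}\<close> 1 2])
        show False using tie[OF y(1), of i j] all_rows_distinct(1)[OF two_two(1)] nb y(2) by simp
      qed
      have ne: "diff_cols c (K - {x}) i k \<noteq> {}" "diff_cols c (K - {x}) i l \<noteq> {}"
        using two_two(3,4) unfolding even_dist_def by auto
      have ij: "diff_cols c (K - {x}) i j \<noteq> {}"
        using ne(1) cols by (fastforce simp: diff_cols_def)
      have bal: "\<forall>z\<in>K. (c i z = c j z) = (c k z = c l z)"
      proof
        fix z assume "z \<in> K"
        then show "(c i z = c j z) = (c k z = c l z)"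
          using cols[of z] x(2) unfolding const_col_def all_rows_lt[OF two_two(1)] by blast
      qed
      have sub: "diff_cols c (K - {x}) r s \<subseteq> diff_cols c K r s" for r s
        by (auto simp: diff_cols_def)
      show "linear_form c K"
        unfolding linear_form_def
        by (rule exI[of _ i], rule exI[of _ j], rule exI[of _ k], rule exI[of _ l])
          (intro conjI two_two(1) bal; use sub[of i j] sub[of i k] sub[of i l] ne ij in blast)
    qed
  qed
qed

text \<open>
  Rows \<open>i\<close> and \<open>j\<close> coincide, and so do \<open>k\<close> and \<open>l\<close>; hence nearest rows come in these pairs, and a column \<open>ik|jl\<close>
  splits every word. The old column does not split the word that is row \<open>i\<close> itself.
\<close>

lemma single_pairing_beaten:
  assumes fin: "finite K" and rows: "all_rows i j k l" and n: "2 \<le> card K"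
    and cols: "\<And>z. z \<in> K \<Longrightarrow> c i z = c j z \<and> c k z = c l z \<and> c i z \<noteq> c k z"
  shows "beaten c K"
proof -
  note lt = all_rows_lt[OF rows] and d = all_rows_distinct[OF rows]
  obtain x where x: "x \<in> K" using n by fastforce
  have fin': "finite (K - {x})" using fin by simp
  have "card (K - {x}) \<ge> 1" using n fin x by simp
  then have "K - {x} \<noteq> {}" by (metis card.empty not_one_le_zero)
  then obtain x' where x': "x' \<in> K - {x}" by blast
  have wd: "word_dist c (K - {x}) j = word_dist c (K - {x}) i" "word_dist c (K - {x}) l = word_dist c (K - {x}) k"
    using cols by (auto simp: word_dist_def fun_eq_iff intro!: arg_cong[where f = card])
  then have near: "j \<in> nearest c (K - {x}) y \<longleftrightarrow> i \<in> nearest c (K - {x}) y"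
    "l \<in> nearest c (K - {x}) y \<longleftrightarrow> k \<in> nearest c (K - {x}) y" for y
    by (auto simp: nearest_def lt)
  let ?y = "flip_in_row c (K - {x}) i {}"
  have "x' \<in> {z \<in> K - {x}. c k z \<noteq> (z \<in> ?y)}" using x' cols by (auto simp: flip_in_row_def)
  then have k0: "0 < word_dist c (K - {x}) k ?y" unfolding word_dist_def using fin
    by (auto simp: card_gt_0_iff)
  have "{z \<in> K - {x}. c i z \<noteq> (z \<in> ?y)} = {}" by (auto simp: flip_in_row_def)
  then have i0: "word_dist c (K - {x}) i ?y = 0" by (simp only: word_dist_def card.empty)
  have y: "nearest c (K - {x}) ?y = {i, j}"
    using wd k0 i0 by (auto simp: nearest_def lt)
  have "splits (\<lambda>r. r = i \<or> r = k) (nearest c (K - {x}) y)" for y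
  proof -
    obtain r where "r \<in> nearest c (K - {x}) y" by (rule min_dist_attained)
    then have "i \<in> nearest c (K - {x}) y \<and> j \<in> nearest c (K - {x}) y \<or>
      k \<in> nearest c (K - {x}) y \<and> l \<in> nearest c (K - {x}) y"
      using near nearest_rows[OF rows, of c "K - {x}" y] by blast
    then show ?thesis
      using d splitsI[of i _ j "\<lambda>r. r = i \<or> r = k"] splitsI[of k _ l "\<lambda>r. r = i \<or> r = k"] by simp blast
  qed
  note all = this
  have "\<not> splits (\<lambda>r. c r x) (nearest c (K - {x}) ?y)"
    unfolding y using cols[OF x] by (auto simp: splits_def)
  then show ?thesis by (rule beaten_by_set_column[OF fin x all flip_in_row_subset all])
qed

lemma no_lone_column_linear_or_beaten:
  assumes fin: "finite K" and n: "2 \<le> card K"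
    and nonconst: "\<And>z. z \<in> K \<Longrightarrow> \<not> const_col c z"
    and nolone: "\<And>z i. z \<in> K \<Longrightarrow> i < 4 \<Longrightarrow> \<not> lone c z i"
  shows "linear_form c K \<or> beaten c K"
proof -
  have rows: "all_rows 0 1 2 3" "all_rows 0 2 1 3" "all_rows 0 3 1 2"
    by (auto simp: all_rows_def)
  note lt = all_rows_lt[OF rows(1)]
  have cols: "(c 0 z = c 1 z) = (c 2 z = c 3 z)" "\<not> (c 0 z = c 1 z \<and> c 0 z = c 2 z)" if "z \<in> K" for z
  proof -
    have "\<not> (c 0 z = c 1 z \<and> c 0 z = c 2 z \<and> c 0 z = c 3 z)"
    proof
      assume "c 0 z = c 1 z \<and> c 0 z = c 2 z \<and> c 0 z = c 3 z"
      then have "const_col c z" unfolding const_col_def lt by auto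
      then show False using nonconst[OF that] by contradiction
    qed
    moreover have "\<not> (c 1 z \<noteq> c 0 z \<and> c 2 z \<noteq> c 0 z \<and> c 3 z \<noteq> c 0 z)"
      using nolone[OF that, of 0] unfolding lone_def lt by auto
    moreover have "\<not> (c 0 z \<noteq> c 1 z \<and> c 2 z \<noteq> c 1 z \<and> c 3 z \<noteq> c 1 z)"
      using nolone[OF that, of 1] unfolding lone_def lt by auto
    moreover have "\<not> (c 0 z \<noteq> c 2 z \<and> c 1 z \<noteq> c 2 z \<and> c 3 z \<noteq> c 2 z)"
      using nolone[OF that, of 2] unfolding lone_def lt by auto
    moreover have "\<not> (c 0 z \<noteq> c 3 z \<and> c 1 z \<noteq> c 3 z \<and> c 2 z \<noteq> c 3 z)"
      using nolone[OF that, of 3] unfolding lone_def lt by auto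
    ultimately show "(c 0 z = c 1 z) = (c 2 z = c 3 z)" "\<not> (c 0 z = c 1 z \<and> c 0 z = c 2 z)"
      by blast+
  qed
  show ?thesis
  proof (rule disjCI)
    assume nb: "\<not> beaten c K"
    have ne: "diff_cols c K 0 r \<noteq> {}" if "all_rows 0 r s t"
      "\<And>z. z \<in> K \<Longrightarrow> c 0 z = c r z \<Longrightarrow> c s z = c t z \<and> c 0 z \<noteq> c s z" for r s t
    proof
      assume "diff_cols c K 0 r = {}"
      then have "c 0 z = c r z" if "z \<in> K" for z using that unfolding diff_cols_def by blast
      then show False using single_pairing_beaten[OF fin that(1) n, of c] that(2) nb by blast
    qed
    have "diff_cols c K 0 1 \<noteq> {}" by (rule ne[OF rows(1)]) (use cols in auto)
    moreover have "diff_cols c K 0 2 \<noteq> {}" by (rule ne[OF rows(2)]) (use cols in blast)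
    moreover have "diff_cols c K 0 3 \<noteq> {}" by (rule ne[OF rows(3)]) (use cols in blast)
    ultimately show "linear_form c K"
      unfolding linear_form_def using rows(1) cols(1) by blast
  qed
qed


definition only_lone :: "(nat \<Rightarrow> nat \<Rightarrow> bool) \<Rightarrow> nat set \<Rightarrow> nat \<Rightarrow> bool" where
  "only_lone c K i \<longleftrightarrow> (\<forall>x\<in>K. \<not> const_col c x \<and> (\<forall>r<4. lone c x r \<longrightarrow> r = i))"

text \<open>
  Class-I and Class-II up to equivalence, with row \<open>i\<close> in the part of the last row. The parities of the four
  column counts are expressed by parities of distances; \<open>num_types_arrange\<close> translates back.
\<close>

definition class_I_form :: "(nat \<Rightarrow> nat \<Rightarrow> bool) \<Rightarrow> nat set \<Rightarrow> bool" where
  "class_I_form c K \<longleftrightarrow> (\<exists>a b d i. all_rows a b d i \<and> only_lone c K i \<and>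
     even_dist c K a b \<and> even_dist c K a d \<and> \<not> even_dist c K a i)"

definition class_II_form :: "(nat \<Rightarrow> nat \<Rightarrow> bool) \<Rightarrow> nat set \<Rightarrow> bool" where
  "class_II_form c K \<longleftrightarrow> (\<exists>a b d i. all_rows a b d i \<and> only_lone c K i \<and> (\<exists>x\<in>K. lone c x i) \<and>
     even_dist c K a b \<and> \<not> even_dist c K a d \<and> \<not> even_dist c K a i)"

lemma lone_column_class_II_or_beaten:
  assumes fin: "finite K" and rows: "all_rows i j k l" and n: "4 \<le> card K"
    and x: "x \<in> K" "lone c x i"
    and nonconst: "\<And>z. z \<in> K \<Longrightarrow> \<not> const_col c z"
    and even: "\<not> even_dist c (K - {x}) i j" "even_dist c (K - {x}) i k" "even_dist c (K - {x}) i l"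
  shows "class_II_form c K \<or> beaten c K"
proof (cases "only_lone c K i")
  case True
  have fin': "finite (K - {x})" using fin by simp
  obtain f :: "nat \<Rightarrow> bool" where "\<forall>r s. even_dist c (K - {x}) r s \<longleftrightarrow> f r = f s"
    by (rule even_dist_colouring[OF fin', where c = c])
  note f = this[rule_format]
  have lx: "c j x \<noteq> c i x" "c k x \<noteq> c i x" "c l x \<noteq> c i x"
    using x(2) all_rows_distinct[OF rows] unfolding lone_def all_rows_lt[OF rows] by auto
  have "even_dist c K k l" "\<not> even_dist c K k j" "\<not> even_dist c K k i"
    unfolding even_dist_remove[OF fin x(1)] using lx even unfolding f by auto
  moreover have "all_rows k l j i" using rows unfolding all_rows_def by auto
  ultimately show ?thesis using True x unfolding class_II_form_def by blast
next
  case False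
  then obtain x' i' where "x' \<in> K" "i' < 4" "i' \<noteq> i" "lone c x' i'"
    using nonconst unfolding only_lone_def by blast
  then show ?thesis using two_lone_rows_beaten_three_one[OF fin rows n x nonconst even] by blast
qed

lemma lone_column_class_I_or_beaten:
  assumes fin: "finite K" and rows: "all_rows i j k l" and n: "4 \<le> card K"
    and x: "x \<in> K" "lone c x i"
    and nonconst: "\<And>z. z \<in> K \<Longrightarrow> \<not> const_col c z"
    and even: "even_dist c (K - {x}) i j" "even_dist c (K - {x}) i k" "even_dist c (K - {x}) i l"
  shows "class_I_form c K \<or> beaten c K"
proof (cases "only_lone c K i")
  case True
  have fin': "finite (K - {x})" using fin by simp
  obtain f :: "nat \<Rightarrow> bool" where "\<forall>r s. even_dist c (K - {x}) r s \<longleftrightarrow> f r = f s"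
    by (rule even_dist_colouring[OF fin', where c = c])
  note f = this[rule_format]
  have lx: "c j x \<noteq> c i x" "c k x \<noteq> c i x" "c l x \<noteq> c i x"
    using x(2) all_rows_distinct[OF rows] unfolding lone_def all_rows_lt[OF rows] by auto
  have "even_dist c K j k" "even_dist c K j l" "\<not> even_dist c K j i"
    unfolding even_dist_remove[OF fin x(1)] using lx even unfolding f by auto
  moreover have "all_rows j k l i" using rows unfolding all_rows_def by auto
  ultimately show ?thesis using True unfolding class_I_form_def by blast
next
  case False
  then obtain x' i' where x': "x' \<in> K" "i' < 4" "i' \<noteq> i" "lone c x' i'"
    using nonconst unfolding only_lone_def by blast
  have rows': "all_rows i k j l" "all_rows i l j k" using rows unfolding all_rows_def by auto
  from x'(2,3) consider "i' = j" | "i' = k" | "i' = l" unfolding all_rows_lt[OF rows] by blast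
  then have "beaten c K"
  proof cases
    case 1
    show ?thesis
      by (rule two_lone_rows_beaten_even[OF fin rows n x nonconst even x'(1) x'(4)[unfolded 1]])
  next
    case 2
    show ?thesis
      by (rule two_lone_rows_beaten_even[OF fin rows'(1) n x nonconst even(2,1,3) x'(1) x'(4)[unfolded 2]])
  next
    case 3
    show ?thesis
      by (rule two_lone_rows_beaten_even[OF fin rows'(2) n x nonconst even(3,1,2) x'(1) x'(4)[unfolded 3]])
  qed
  then show ?thesis ..
qed

text \<open>
  The case distinction: constant column, only pairings, or a lone column at some row \<open>i\<close>; in the last case
  the number of rows at even distance from \<open>i\<close> in the rest of the code decides.
\<close>

lemma normal_form_or_beaten:
  assumes fin: "finite K" and n: "4 \<le> card K"
  shows "linear_form c K \<or> class_I_form c K \<or> class_II_form c K \<or> beaten c K"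
proof (cases "\<exists>x\<in>K. const_col c x")
  case True
  then show ?thesis using const_column_linear_or_beaten[OF fin] by blast
next
  case False
  then have nonconst: "\<And>z. z \<in> K \<Longrightarrow> \<not> const_col c z" by blast
  show ?thesis
  proof (cases "\<exists>x\<in>K. \<exists>i<4. lone c x i")
    case False
    have "2 \<le> card K" using n by simp
    then show ?thesis using no_lone_column_linear_or_beaten[OF fin _ nonconst] False by blast
  next
    case True
    then obtain x i where x: "x \<in> K" "lone c x i" and i: "i < 4" by blast
    obtain j k l where rows: "all_rows i j k l"
    proof -
      from i consider "i = 0" | "i = 1" | "i = 2" | "i = 3" by linarith
      then show thesis
      proof cases
        case 1 show thesis by (rule that[of 1 2 3]) (auto simp: 1 all_rows_def)
      next
        case 2 show thesis by (rule that[of 0 2 3]) (auto simp: 2 all_rows_def)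
      next
        case 3 show thesis by (rule that[of 0 1 3]) (auto simp: 3 all_rows_def)
      next
        case 4 show thesis by (rule that[of 0 1 2]) (auto simp: 4 all_rows_def)
      qed
    qed
    have perms: "all_rows i k j l" "all_rows i l j k"
      using rows unfolding all_rows_def by auto
    note two_two = lone_column_two_two_beaten[OF fin _ n x nonconst]
    note three_one = lone_column_class_II_or_beaten[OF fin _ n x nonconst]
    let ?E = "even_dist c (K - {x}) i"
    consider "?E j" "?E k" "?E l" | "\<not> ?E j" "\<not> ?E k" "\<not> ?E l"
      | "?E j" "\<not> ?E k" "\<not> ?E l" | "\<not> ?E j" "?E k" "\<not> ?E l" | "\<not> ?E j" "\<not> ?E k" "?E l"
      | "\<not> ?E j" "?E k" "?E l" | "?E j" "\<not> ?E k" "?E l" | "?E j" "?E k" "\<not> ?E l" by blast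
    then show ?thesis
    proof cases
      case 1 then show ?thesis using lone_column_class_I_or_beaten[OF fin rows n x nonconst] by blast
    next
      case 2 then show ?thesis using lone_column_isolated_row_beaten[OF fin rows x] by blast
    next
      case 3 then show ?thesis using two_two[OF perms(1)] by blast
    next
      case 4 then show ?thesis using two_two[OF rows] by blast
    next
      case 5
      moreover have "all_rows i j l k" using rows unfolding all_rows_def by auto
      ultimately show ?thesis using two_two by blast
    next
      case 6 then show ?thesis using three_one[OF rows] by blast
    next
      case 7 then show ?thesis using three_one[OF perms(1)] by blast
    next
      case 8 then show ?thesis using three_one[OF perms(2)] by blast
    qed
  qed
qed

section \<open>Translation to matrices\<close>

definition entry :: "bool mat \<Rightarrow> nat \<Rightarrow> nat \<Rightarrow> bool" where
  "entry C r x = C $$ (r, x)"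

lemma code_dist_eq_min_dist:
  assumes "C \<in> codes n" "Y \<subseteq> {0..<n}"
  shows "code_dist C (vec n (\<lambda>x. x \<in> Y)) = min_dist (entry C) {0..<n} Y"
proof -
  have "hamming_dist (row C r) (vec n (\<lambda>x. x \<in> Y)) = word_dist (entry C) {0..<n} r Y" if "r < 4" for r
  proof -
    have "{x. x < dim_vec (row C r) \<and> row C r $ x \<noteq> vec n (\<lambda>x. x \<in> Y) $ x} =
        {x \<in> {0..<n}. entry C r x \<noteq> (x \<in> Y)}"
      using assms that by (auto simp: codes_def entry_def)
    then show ?thesis by (simp only: hamming_dist_def word_dist_def)
  qed
  then have "(\<lambda>r. hamming_dist (row C r) (vec n (\<lambda>x. x \<in> Y))) ` {0..<4} =
      (\<lambda>r. word_dist (entry C) {0..<n} r Y) ` {0..<4}"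
    by (intro image_cong) auto
  then show ?thesis unfolding code_dist_def min_dist_def by simp
qed

lemma success_prob_eq_weight:
  assumes C: "C \<in> codes n" and e: "0 < \<epsilon>" "\<epsilon> < 1"
  shows "success_prob C \<epsilon> = 1 / 4 * (1 - \<epsilon>) ^ n * weight (entry C) {0..<n} (\<epsilon> / (1 - \<epsilon>))"
proof -
  have dim: "dim_col C = n" using C by (auto simp: codes_def)
  let ?v = "\<lambda>Y. vec n (\<lambda>x. x \<in> Y)"
  have bij: "bij_betw ?v (Pow {0..<n}) (carrier_vec n)"
  proof (rule bij_betw_byWitness[where f' = "\<lambda>y. {x \<in> {0..<n}. y $ x}"])
    show "\<forall>y\<in>carrier_vec n. ?v {x \<in> {0..<n}. y $ x} = y" by auto
  qed auto
  have "(\<Sum>y\<in>carrier_vec n. (1 - \<epsilon>) ^ (n - code_dist C y) * \<epsilon> ^ code_dist C y) =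
      (\<Sum>Y\<in>Pow {0..<n}. (1 - \<epsilon>) ^ (n - code_dist C (?v Y)) * \<epsilon> ^ code_dist C (?v Y))"
    by (rule sum.reindex_bij_betw[OF bij, symmetric])
  also have "\<dots> = (\<Sum>Y\<in>Pow {0..<n}. (1 - \<epsilon>) ^ n * (\<epsilon> / (1 - \<epsilon>)) ^ min_dist (entry C) {0..<n} Y)"
  proof (rule sum.cong[OF refl])
    fix Y assume "Y \<in> Pow {0..<n}"
    then have d: "code_dist C (?v Y) = min_dist (entry C) {0..<n} Y"
      using code_dist_eq_min_dist[OF C] by blast
    have "min_dist (entry C) {0..<n} Y \<le> word_dist (entry C) {0..<n} 0 Y"
      by (rule min_dist_le) simp
    also have "\<dots> \<le> card {0..<n}" unfolding word_dist_def by (intro card_mono) auto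
    finally have "min_dist (entry C) {0..<n} Y \<le> n" by simp
    then show "(1 - \<epsilon>) ^ (n - code_dist C (?v Y)) * \<epsilon> ^ code_dist C (?v Y) =
        (1 - \<epsilon>) ^ n * (\<epsilon> / (1 - \<epsilon>)) ^ min_dist (entry C) {0..<n} Y"
      using e unfolding d by (simp add: power_diff power_divide)
  qed
  finally show ?thesis
    unfolding success_prob_def dim weight_def by (simp add: sum_distrib_left mult.assoc)
qed

lemma univ_strictly_better_if_beaten:
  assumes C: "C \<in> codes n" and "beaten (entry C) {0..<n}"
  shows "\<exists>D\<in>codes n. univ_strictly_better D C"
proof -
  obtain c' where c': "\<And>q. 0 < q \<and> q < 1 \<longrightarrow> weight (entry C) {0..<n} q < weight c' {0..<n} q"
    using assms(2) unfolding beaten_def by blast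
  define D where "D = mat 4 n (\<lambda>(r, x). c' r x)"
  have D: "D \<in> codes n" by (simp add: codes_def D_def)
  have "word_dist (entry D) {0..<n} r y = word_dist c' {0..<n} r y" if "r < 4" for r y
    using that unfolding word_dist_def by (intro arg_cong[where f = card]) (auto simp: entry_def D_def)
  then have "min_dist (entry D) {0..<n} y = min_dist c' {0..<n} y" for y
    unfolding min_dist_def by (intro arg_cong[where f = Min] image_cong) auto
  then have w: "weight (entry D) {0..<n} q = weight c' {0..<n} q" for q
    by (simp add: weight_def)
  have "success_prob C \<epsilon> < success_prob D \<epsilon>" if "0 < \<epsilon>" "\<epsilon> < 1 / 2" for \<epsilon>
  proof -
    have "0 < \<epsilon> / (1 - \<epsilon>)" "\<epsilon> / (1 - \<epsilon>) < 1" using that by (simp_all add: divide_simps)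
    then show ?thesis
      using c'[of "\<epsilon> / (1 - \<epsilon>)"] that
      by (simp add: success_prob_eq_weight[OF C] success_prob_eq_weight[OF D] w)
  qed
  then show ?thesis using D unfolding univ_strictly_better_def by blast
qed

text \<open>
  The rows \<open>a\<close>, \<open>b\<close>, \<open>d\<close>, \<open>i\<close> become the rows 0 to 3, and columns are complemented so that row 0 vanishes. Column
  types then are at most 7 and encode in which rows a column differs from row \<open>a\<close>.
\<close>

definition arrange :: "bool mat \<Rightarrow> nat \<Rightarrow> nat \<Rightarrow> nat \<Rightarrow> nat \<Rightarrow> bool mat" where
  "arrange C a b d i = mat 4 (dim_col C) (\<lambda>(r, x). C $$ ([a, b, d, i] ! r, x) \<noteq> C $$ (a, x))"

lemma code_equiv_arrange:
  assumes rows: "all_rows a b d i"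
  shows "code_equiv C (arrange C a b d i)"
proof -
  let ?S = "{x \<in> {0..<dim_col C}. C $$ (a, x)}"
  have "bij_betw (\<lambda>r. [a, b, d, i] ! r) {..<4} {0..<4}"
    using bij_betw_nth[of "[a, b, d, i]" "{..<4}" "{0..<4}"] rows by (simp add: all_rows_def)
  then have \<sigma>: "bij_betw (\<lambda>r. [a, b, d, i] ! r) {0..<4} {0..<4}" by (simp add: lessThan_atLeast0)
  have "arrange C a b d i =
      mat 4 (dim_col C) (\<lambda>(r, x). C $$ ([a, b, d, i] ! r, id x) \<noteq> (x \<in> ?S))"
    unfolding arrange_def by (intro cong_mat) auto
  then show ?thesis
    unfolding code_equiv_def
    by (intro exI[of _ "\<lambda>r. [a, b, d, i] ! r"] exI[of _ id] exI[of _ ?S] conjI \<sigma> bij_betw_id) auto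
qed

lemma col_type_arrange:
  assumes "x < dim_col C"
  shows "col_type (arrange C a b d i) x =
    4 * of_bool (entry C a x \<noteq> entry C b x) + 2 * of_bool (entry C a x \<noteq> entry C d x)
      + of_bool (entry C a x \<noteq> entry C i x)"
  using assms by (auto simp: col_type_def arrange_def entry_def)

lemma num_type_arrange:
  assumes "C \<in> codes n"
  shows "num_type (arrange C a b d i) (4 * of_bool p + 2 * of_bool q + of_bool r) =
    pattern_count (entry C) {0..<n} a b d i p q r"
proof -
  have dim: "dim_col C = n" "dim_col (arrange C a b d i) = n"
    using assms by (auto simp: codes_def arrange_def)
  have "{x. x < n \<and> col_type (arrange C a b d i) x = 4 * of_bool p + 2 * of_bool q + of_bool r} =
      {x \<in> {0..<n}. (entry C a x \<noteq> entry C b x) = p \<and> (entry C a x \<noteq> entry C d x) = q \<and>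
        (entry C a x \<noteq> entry C i x) = r}"
    using col_type_arrange[of _ C a b d i] dim by (auto split: if_splits simp: of_bool_def)
  then show ?thesis by (simp only: num_type_def pattern_count_def dim)
qed

text \<open>
  Type 3 is the pairing \<open>ij|kl\<close>, type 5 is \<open>ik|jl\<close> and type 6 is \<open>il|jk\<close>. That row \<open>i\<close> differs from each other row
  excludes that only one of them occurs.
\<close>

lemma linear_code_arrange:
  assumes C: "C \<in> codes n" and lin: "linear_form (entry C) {0..<n}"
  obtains C' where "code_equiv C C'" "linear_code C'"
proof -
  obtain i j k l where rows: "all_rows i j k l"
    and bal: "\<And>x. x \<in> {0..<n} \<Longrightarrow> (entry C i x = entry C j x) = (entry C k x = entry C l x)"
    and ne: "diff_cols (entry C) {0..<n} i j \<noteq> {}" "diff_cols (entry C) {0..<n} i k \<noteq> {}"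
      "diff_cols (entry C) {0..<n} i l \<noteq> {}"
    using lin unfolding linear_form_def by blast
  let ?C = "arrange C i j k l"
  have dim: "dim_col C = n" "dim_col ?C = n"
    using C by (auto simp: codes_def arrange_def)
  have types: "col_type ?C x \<in> {0, 3, 5, 6}" if "x < n" for x
    using bal[of x] that dim by (auto simp: col_type_arrange)
  have pos: "num_type ?C (col_type ?C x) > 0" if "x < n" for x
  proof -
    have "{x'. x' < n \<and> col_type ?C x' = col_type ?C x} \<noteq> {}" using that by auto
    then show ?thesis by (simp add: num_type_def dim card_gt_0_iff)
  qed
  obtain x y z where x: "x < n" "entry C i x \<noteq> entry C j x" and y: "y < n" "entry C i y \<noteq> entry C k y"
    and z: "z < n" "entry C i z \<noteq> entry C l z"
    using ne by (auto simp: diff_cols_def)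
  let ?P = "\<lambda>t. num_type ?C t > 0"
  have "col_type ?C x = 5 \<or> col_type ?C x = 6" using x bal[of x] dim by (auto simp: col_type_arrange)
  then have 1: "?P 5 \<or> ?P 6" using pos[OF x(1)] by auto
  have "col_type ?C y = 3 \<or> col_type ?C y = 6" using y bal[of y] dim by (auto simp: col_type_arrange)
  then have 2: "?P 3 \<or> ?P 6" using pos[OF y(1)] by auto
  have "col_type ?C z = 3 \<or> col_type ?C z = 5" using z bal[of z] dim by (auto simp: col_type_arrange)
  then have 3: "?P 3 \<or> ?P 5" using pos[OF z(1)] by auto
  from 1 2 3 consider "?P 3" "?P 5" | "?P 3" "?P 6" | "?P 5" "?P 6" by satx
  then have "\<exists>s t. s \<noteq> t \<and> {s, t} \<subseteq> {t \<in> {3, 5, 6}. ?P t}"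
  proof cases
    case 1 then show ?thesis by (intro exI[of _ 3] exI[of _ 5]) auto
  next
    case 2 then show ?thesis by (intro exI[of _ 3] exI[of _ 6]) auto
  next
    case 3 then show ?thesis by (intro exI[of _ 5] exI[of _ 6]) auto
  qed
  then obtain s t where st: "s \<noteq> t" "{s, t} \<subseteq> {t \<in> {3, 5, 6}. num_type ?C t > 0}" by blast
  have "card {s, t} \<le> card {t \<in> {3, 5, 6}. num_type ?C t > 0}"
    by (rule card_mono[OF _ st(2)]) simp
  then have "linear_code ?C" using st(1) types dim unfolding linear_code_def by simp
  then show thesis using that code_equiv_arrange[OF rows] by blast
qed

lemma only_lone_pattern_counts:
  assumes fin: "finite K" and rows: "all_rows a b d i" and only: "only_lone c K i"
  defines "N \<equiv> pattern_count c K a b d i"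
  shows "N False False True + N False True True + N True False True + N True True False = card K"
    and "card (diff_cols c K a b) = N True False True + N True True False"
    and "card (diff_cols c K a d) = N False True True + N True True False"
    and "card (diff_cols c K a i) = N False False True + N False True True + N True False True"
proof -
  have cols: "\<not> (c a x = c b x \<and> c a x = c d x \<and> c a x = c i x)"
    "\<not> (c a x \<noteq> c b x \<and> c a x \<noteq> c d x \<and> c a x \<noteq> c i x)"
    "\<not> (c a x \<noteq> c b x \<and> c a x = c d x \<and> c a x = c i x)"
    "\<not> (c a x = c b x \<and> c a x \<noteq> c d x \<and> c a x = c i x)" if "x \<in> K" for x
  proof -
    have "a < 4" "b < 4" "d < 4" using all_rows_lt[OF rows] by blast+
    then have *: "\<not> const_col c x" "\<not> lone c x a" "\<not> lone c x b" "\<not> lone c x d"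
      using only that all_rows_distinct[OF rows] unfolding only_lone_def by blast+
    show "\<not> (c a x = c b x \<and> c a x = c d x \<and> c a x = c i x)"
      using *(1) unfolding const_col_def all_rows_lt[OF rows] by auto
    show "\<not> (c a x \<noteq> c b x \<and> c a x \<noteq> c d x \<and> c a x \<noteq> c i x)"
      using *(2) unfolding lone_def all_rows_lt[OF rows] by auto
    show "\<not> (c a x \<noteq> c b x \<and> c a x = c d x \<and> c a x = c i x)"
      using *(3) unfolding lone_def all_rows_lt[OF rows] by auto
    show "\<not> (c a x = c b x \<and> c a x \<noteq> c d x \<and> c a x = c i x)"
      using *(4) unfolding lone_def all_rows_lt[OF rows] by auto
  qed
  have K: "card K = (\<Sum>x\<in>K. 1)" by simp
  show "N False False True + N False True True + N True False True + N True True False = card K"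
    unfolding N_def pattern_count_def card_filter_sum[OF fin] sum.distrib[symmetric] K
    by (intro sum.cong refl) (use cols in \<open>simp; blast\<close>)
  have "N True False False = 0" "N True True True = 0" "N False True False = 0"
    unfolding N_def pattern_count_def using cols fin by auto
  then show "card (diff_cols c K a b) = N True False True + N True True False"
    "card (diff_cols c K a d) = N False True True + N True True False"
    "card (diff_cols c K a i) = N False False True + N False True True + N True False True"
    using card_diff_cols_pattern[OF fin, where c = c and i = a and j = b and k = d and l = i]
    unfolding N_def by simp_all
qed

text \<open>
  Type 1 are the lone columns at \<open>i\<close>. Rows \<open>a\<close> and \<open>b\<close>, for example, differ in the columns of types 5 and 6.
\<close>

lemma num_types_arrange:
  assumes C: "C \<in> codes n" and rows: "all_rows a b d i" and only: "only_lone (entry C) {0..<n} i"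
  defines "N \<equiv> num_type (arrange C a b d i)"
  shows "N 1 + N 3 + N 5 + N 6 = n"
    and "even_dist (entry C) {0..<n} a b \<longleftrightarrow> even (N 5 + N 6)"
    and "even_dist (entry C) {0..<n} a d \<longleftrightarrow> even (N 3 + N 6)"
    and "even_dist (entry C) {0..<n} a i \<longleftrightarrow> even (N 1 + N 3 + N 5)"
proof -
  note T = num_type_arrange[OF C, of a b d i]
  have "N 1 = pattern_count (entry C) {0..<n} a b d i False False True"
    "N 3 = pattern_count (entry C) {0..<n} a b d i False True True"
    "N 5 = pattern_count (entry C) {0..<n} a b d i True False True"
    "N 6 = pattern_count (entry C) {0..<n} a b d i True True False"
    unfolding N_def using T[of False False True] T[of False True True] T[of True False True]
      T[of True True False] by (simp_all add: numeral_3_eq_3)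
  then show "N 1 + N 3 + N 5 + N 6 = n"
    "even_dist (entry C) {0..<n} a b \<longleftrightarrow> even (N 5 + N 6)"
    "even_dist (entry C) {0..<n} a d \<longleftrightarrow> even (N 3 + N 6)"
    "even_dist (entry C) {0..<n} a i \<longleftrightarrow> even (N 1 + N 3 + N 5)"
    using only_lone_pattern_counts[OF _ rows only] by (simp_all only: even_dist_def finite_atLeastLessThan card_atLeastLessThan diff_zero)
qed

lemma class_I_arrange:
  assumes C: "C \<in> codes n" and form: "class_I_form (entry C) {0..<n}"
  obtains C' where "code_equiv C C'" "class_I C'"
proof -
  obtain a b d i where rows: "all_rows a b d i" and only: "only_lone (entry C) {0..<n} i"
    and "even_dist (entry C) {0..<n} a b" "even_dist (entry C) {0..<n} a d"
      "\<not> even_dist (entry C) {0..<n} a i"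
    using form unfolding class_I_form_def by blast
  moreover have "dim_col (arrange C a b d i) = n" using C by (auto simp: codes_def arrange_def)
  ultimately have "class_I (arrange C a b d i)"
    using num_types_arrange[OF C rows only] unfolding class_I_def by auto
  then show thesis using that code_equiv_arrange[OF rows] by blast
qed

lemma class_II_arrange:
  assumes C: "C \<in> codes n" and form: "class_II_form (entry C) {0..<n}"
  obtains C' where "code_equiv C C'" "class_II C'"
proof -
  obtain a b d i x where rows: "all_rows a b d i" and only: "only_lone (entry C) {0..<n} i"
    and x: "x \<in> {0..<n}" "lone (entry C) x i"
    and parity: "even_dist (entry C) {0..<n} a b" "\<not> even_dist (entry C) {0..<n} a d"
      "\<not> even_dist (entry C) {0..<n} a i"
    using form unfolding class_II_form_def by blast
  let ?C = "arrange C a b d i"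
  have dim: "dim_col C = n" "dim_col ?C = n" using C by (auto simp: codes_def arrange_def)
  have "col_type ?C x = 1"
    using x dim all_rows_distinct[OF rows] unfolding lone_def all_rows_lt[OF rows]
    by (auto simp: col_type_arrange)
  then have "x \<in> {x. x < dim_col ?C \<and> col_type ?C x = 1}" using x dim by simp
  then have "num_type ?C 1 > 0" unfolding num_type_def by (auto simp: card_gt_0_iff)
  then have "class_II ?C"
    using num_types_arrange[OF C rows only] parity dim unfolding class_II_def by auto
  then show thesis using that code_equiv_arrange[OF rows] by blast
qed

theorem theorem3:
  fixes n :: nat and C :: "bool mat"
  assumes "n > 3"
    and "C \<in> codes n"
    and "\<not> (\<exists>C'. code_equiv C C' \<and> (linear_code C' \<or> class_I C' \<or> class_II C'))"
  shows "\<exists>D \<in> codes n. univ_strictly_better D C"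
proof -
  have "\<not> linear_form (entry C) {0..<n}"
    using linear_code_arrange[OF assms(2)] assms(3) by blast
  moreover have "\<not> class_I_form (entry C) {0..<n}"
    using class_I_arrange[OF assms(2)] assms(3) by blast
  moreover have "\<not> class_II_form (entry C) {0..<n}"
    using class_II_arrange[OF assms(2)] assms(3) by blast
  ultimately have "beaten (entry C) {0..<n}"
    using normal_form_or_beaten[of "{0..<n}" "entry C"] assms(1) by auto
  then show ?thesis by (rule univ_strictly_better_if_beaten[OF assms(2)])
qed

end
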